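(* Let $n$ be an even positive integer, let $G=\mathrm{SO}(n+1)$, and let $a=\mathrm{diag}(1,1,\dots,1,-1)\in\mathrm{O}(n)$ be identified with $a=\mathrm{diag}(1,1,\dots,1,-1,-1)\in\mathrm{SO}(n+1)$. Let $(V_\tau,\tau)$ be a unitary irreducible (finite dimensional, complex) representation of $G$ and $(V_\pi,\pi)$ a unitary irreducible representation of $\mathrm{SO}(n)$. Suppose that $\pi$ is a sub-representation of $\tau_{|\mathrm{SO}(n)}$ and that $\pi$ is equivalent to $\pi_\phi$, where $\pi_\phi(k)=\pi(aka)$ for $k\in\mathrm{SO}(n)$. Set $A=\Phi^{\tau,\pi}(a)$ and take $\gamma=\pi\cdot\epsilon_A$ (that is, $A\in\mathrm{GL}(V_\pi)$ satisfies $A^2=I$ and $\pi_\phi(k)=A\pi(k)A^{-1}$ for all $k\in\mathrm{SO}(n)$, so that $\pi\cdot\epsilon_A$ is defined). Then $\Phi^{\tau,\pi}(g)=\Phi^{\tau,\gamma}(g)$ for all $g\in G$.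
   Context: Embeddings: $\mathrm{O}(n)$ is regarded as a subgroup of $G=\mathrm{SO}(n+1)$ via $k\mapsto \begin{pmatrix} k&0\\0&\det k\end{pmatrix}$; restricting gives $\mathrm{SO}(n)\subset G$. With $F=\{1,a\}$ one has $\mathrm{O}(n)=\mathrm{SO}(n)\rtimes F$ for $n$ even. The representation $\pi\cdot\epsilon_A$: if $A\in\mathrm{GL}(V_\pi)$ satisfies $A^2=I$ and $\pi_\phi(k)=A\pi(k)A^{-1}$ for all $k\in\mathrm{SO}(n)$, let $\epsilon_A$ be the representation of $F$ on $V_\pi$ with $\epsilon_A(a)=A$, and define the representation $\pi\cdot\epsilon_A:\mathrm{O}(n)\to\mathrm{GL}(V_\pi)$ by $(\pi\cdot\epsilon_A)(kx)=\pi(k)\epsilon_A(x)$ for $k\in\mathrm{SO}(n)$, $x\in F$. It is irreducible. Spherical functions: let $K$ be a compact subgroup of $G$ with Haar measure $dk$ normalized by $\int_K dk=1$, and let $\delta$ be an irreducible finite dimensional complex representation of $K$ with degree $d(\delta)$, character $\xi_\delta$, and $\chi_\delta=d(\delta)\xi_\delta$. Let $P_\delta=\int_K\chi_\delta(k^{-1})\tau(k)\,dk$ be the projection of $V_\tau$ onto its $\delta$-isotypic subspace $V_\tau(\delta)=P_\delta V_\tau$. The spherical function of type $\delta$ associated with $\tau$ is $\Phi^{\tau,\delta}:G\to\mathrm{End}(V_\tau(\delta))$, $\Phi^{\tau,\delta}(g)v=P_\delta\tau(g)v$ for $v\in V_\tau(\delta)$. Here $\Phi^{\tau,\pi}$ is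 taken with $K=\mathrm{SO}(n)$ and $\Phi^{\tau,\gamma}$ with $K=\mathrm{O}(n)$. Each irreducible representation of $\mathrm{SO}(n)$ occurs in $\tau_{|\mathrm{SO}(n)}$ with multiplicity at most one, so $V_\tau(\pi)$ is identified with $V_\pi$. The equality $\Phi^{\tau,\pi}=\Phi^{\tau,\gamma}$ is an equality of functions with values in the endomorphisms of the same subspace of $V_\tau$ (so it includes $V_\tau(\gamma)=V_\tau(\pi)$). *)

theory Defs
  imports "HOL-Analysis.Analysis"
begin

section \<open>The groups\<close>

text \<open>R^n is \<^typ>\<open>real ^ 'n\<close> with n = CARD('n), and R^(n+1) is \<^typ>\<open>real ^ ('n option)\<close>, the
  extra coordinate being \<^term>\<open>None\<close>.\<close>

definition O_grp :: "(real ^ 'm ^ 'm) set" where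
  "O_grp = {Q. orthogonal_matrix Q}"

definition SO_grp :: "(real ^ 'm ^ 'm) set" where
  "SO_grp = {Q. rotation_matrix Q}"

definition embO :: "real ^ 'n ^ 'n \<Rightarrow> real ^ ('n option) ^ ('n option)" where
  "embO k = (\<chi> i j. case (i, j) of
       (Some r, Some s) \<Rightarrow> k $ r $ s
     | (None, None) \<Rightarrow> det k
     | _ \<Rightarrow> 0)"

text \<open>The matrix diag(1, ..., 1, -1). A finite index type carries no order, so the coordinate that
  plays the role of the last one is a parameter.\<close>

definition refl_mat :: "'n \<Rightarrow> real ^ 'n ^ 'n" where
  "refl_mat l = (\<chi> i j. if i = j then (if i = l then - 1 else 1) else 0)"

text \<open>\<open>M\<close> is the normalized Haar measure on the compact matrix group \<open>K\<close>.\<close>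

definition haar_prob :: "(real ^ 'm ^ 'm) set \<Rightarrow> (real ^ 'm ^ 'm) measure \<Rightarrow> bool" where
  "haar_prob K M \<longleftrightarrow>
     space M = K \<and> sets M = sets (restrict_space borel K) \<and> emeasure M K = 1 \<and>
     (\<forall>h\<in>K. distr M M (\<lambda>k. h ** k) = M)"

section \<open>Representations\<close>

text \<open>A finite dimensional representation space is \<^typ>\<open>complex ^ 'd\<close> with its standard Hermitian
  inner product (coordinates in an orthonormal basis); an operator is its matrix. Complex subspaces
  are those of \<^term>\<open>vec.subspace\<close>.\<close>

definition conj_transpose :: "complex ^ 'd ^ 'e \<Rightarrow> complex ^ 'e ^ 'd" where
  "conj_transpose B = (\<chi> i j. cnj (B $ j $ i))"

definition representation ::
    "(real ^ 'm ^ 'm) set \<Rightarrow> (real ^ 'm ^ 'm \<Rightarrow> complex ^ 'd ^ 'd) \<Rightarrow> bool" where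
  "representation H \<rho> \<longleftrightarrow>
     continuous_on H \<rho> \<and> \<rho> (mat 1) = mat 1 \<and> (\<forall>g\<in>H. \<forall>h\<in>H. \<rho> (g ** h) = \<rho> g ** \<rho> h)"

definition unitary_rep ::
    "(real ^ 'm ^ 'm) set \<Rightarrow> (real ^ 'm ^ 'm \<Rightarrow> complex ^ 'd ^ 'd) \<Rightarrow> bool" where
  "unitary_rep H \<rho> \<longleftrightarrow>
     representation H \<rho> \<and>
     (\<forall>g\<in>H. conj_transpose (\<rho> g) ** \<rho> g = mat 1 \<and> \<rho> g ** conj_transpose (\<rho> g) = mat 1)"

text \<open>The space is nonzero because every type is nonempty.\<close>

definition irreducible_rep ::
    "(real ^ 'm ^ 'm) set \<Rightarrow> (real ^ 'm ^ 'm \<Rightarrow> complex ^ 'd ^ 'd) \<Rightarrow> bool" where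
  "irreducible_rep H \<rho> \<longleftrightarrow>
     representation H \<rho> \<and>
     (\<forall>W. vec.subspace W \<and> (\<forall>g\<in>H. \<forall>w\<in>W. \<rho> g *v w \<in> W) \<longrightarrow> W = {0} \<or> W = UNIV)"

definition equivalent_reps ::
    "(real ^ 'm ^ 'm) set \<Rightarrow> (real ^ 'm ^ 'm \<Rightarrow> complex ^ 'd ^ 'd) \<Rightarrow>
     (real ^ 'm ^ 'm \<Rightarrow> complex ^ 'e ^ 'e) \<Rightarrow> bool" where
  "equivalent_reps H \<rho> \<sigma> \<longleftrightarrow>
     (\<exists>B :: complex ^ 'd ^ 'e. invertible B \<and> (\<forall>g\<in>H. B ** \<rho> g = \<sigma> g ** B))"

text \<open>\<open>T\<close> realizes \<open>\<rho>\<close> as a subrepresentation of \<open>\<sigma>\<close>.\<close>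

definition rep_embedding ::
    "(real ^ 'm ^ 'm) set \<Rightarrow> (real ^ 'm ^ 'm \<Rightarrow> complex ^ 'd ^ 'd) \<Rightarrow>
     (real ^ 'm ^ 'm \<Rightarrow> complex ^ 'e ^ 'e) \<Rightarrow> complex ^ 'd ^ 'e \<Rightarrow> bool" where
  "rep_embedding H \<rho> \<sigma> T \<longleftrightarrow> inj ((*v) T) \<and> (\<forall>g\<in>H. T ** \<rho> g = \<sigma> g ** T)"

definition twist :: "'n \<Rightarrow> (real ^ 'n ^ 'n \<Rightarrow> 'b) \<Rightarrow> real ^ 'n ^ 'n \<Rightarrow> 'b" where
  "twist l \<pi> k = \<pi> (refl_mat l ** k ** refl_mat l)"

text \<open>The representation of O(n) sending \<open>k x\<close>, with \<open>k\<close> in SO(n) and \<open>x\<close> in \<open>{1, a}\<close>, to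
  \<open>\<pi> k\<close> for \<open>x = 1\<close> and to \<open>\<pi> k A\<close> for \<open>x = a\<close>. In the second case \<open>h = k a\<close> has
  determinant -1 and \<open>k = h a\<close>, as \<open>a\<close> is an involution.\<close>

definition rep_eps ::
    "'n \<Rightarrow> (real ^ 'n ^ 'n \<Rightarrow> complex ^ 'd ^ 'd) \<Rightarrow> complex ^ 'd ^ 'd \<Rightarrow>
     real ^ 'n ^ 'n \<Rightarrow> complex ^ 'd ^ 'd" where
  "rep_eps l \<pi> A h = (if h \<in> SO_grp then \<pi> h else \<pi> (h ** refl_mat l) ** A)"

section \<open>Spherical functions\<close>

text \<open>Here \<open>M\<close> is the normalized Haar measure of a compact group \<open>K\<close> of n by n matrices, viewed
  as a subgroup of SO(n+1) through \<^term>\<open>embO\<close>; \<open>\<delta>\<close> represents \<open>K\<close> and \<open>\<tau>\<close> represents SO(n+1).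
  Multiplication by \<^term>\<open>mat c\<close> is multiplication by the scalar \<open>c\<close>.\<close>

definition chi :: "(real ^ 'n ^ 'n \<Rightarrow> complex ^ 'd ^ 'd) \<Rightarrow> real ^ 'n ^ 'n \<Rightarrow> complex" where
  "chi \<delta> k = of_nat CARD('d) * trace (\<delta> k)"

definition isotypic_proj ::
    "(real ^ 'n ^ 'n) measure \<Rightarrow> (real ^ ('n option) ^ ('n option) \<Rightarrow> complex ^ 't ^ 't) \<Rightarrow>
     (real ^ 'n ^ 'n \<Rightarrow> complex ^ 'd ^ 'd) \<Rightarrow> complex ^ 't ^ 't" where
  "isotypic_proj M \<tau> \<delta> = (LINT k|M. mat (chi \<delta> (matrix_inv k)) ** \<tau> (embO k))"

definition isotypic ::
    "(real ^ 'n ^ 'n) measure \<Rightarrow> (real ^ ('n option) ^ ('n option) \<Rightarrow> complex ^ 't ^ 't) \<Rightarrow>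
     (real ^ 'n ^ 'n \<Rightarrow> complex ^ 'd ^ 'd) \<Rightarrow> (complex ^ 't) set" where
  "isotypic M \<tau> \<delta> = range ((*v) (isotypic_proj M \<tau> \<delta>))"

text \<open>The value at \<open>g\<close> is an endomorphism of the isotypic subspace only, hence the restricted
  abstraction.\<close>

definition spherical ::
    "(real ^ 'n ^ 'n) measure \<Rightarrow> (real ^ ('n option) ^ ('n option) \<Rightarrow> complex ^ 't ^ 't) \<Rightarrow>
     (real ^ 'n ^ 'n \<Rightarrow> complex ^ 'd ^ 'd) \<Rightarrow> real ^ ('n option) ^ ('n option) \<Rightarrow>
     complex ^ 't \<Rightarrow> complex ^ 't" where
  "spherical M \<tau> \<delta> g = (\<lambda>v\<in>isotypic M \<tau> \<delta>. isotypic_proj M \<tau> \<delta> *v (\<tau> g *v v))"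

text \<open>The operator \<open>X\<close> on the range of \<open>T\<close>, read as a matrix on the domain of the injective map
  \<open>T\<close>, that is \<open>T\<inverse> X T\<close>.\<close>

definition pull_back ::
    "complex ^ 'd ^ 'e \<Rightarrow> (complex ^ 'e \<Rightarrow> complex ^ 'e) \<Rightarrow> complex ^ 'd ^ 'd" where
  "pull_back T X = matrix (\<lambda>v. inv ((*v) T) (X (T *v v)))"

end

theory Submission
  imports Defs
begin

text \<open>The theorem rests on one fact: an irreducible representation \<open>\<tau>\<close> of SO(n+1), restricted to SO(n),
  contains each irreducible representation at most once (lemma \<open>intertwiner_unique\<close>). Granting this,
  every SO(n)-equivariant map from \<open>\<pi>\<close> to \<open>\<tau>\<close> is a multiple of the given embedding \<open>T\<close>, and three
  things follow. Composing \<open>T\<close> with an equivalence of \<open>\<pi>\<close> with its twist and with \<open>\<tau>(a)\<close> gives another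
  such map, so \<open>\<tau>(a)\<close> preserves the range of \<open>T\<close>; since \<open>A\<close> is the restriction of \<open>\<tau>(a)\<close> to this
  range, it inherits \<open>A\<^sup>2 = 1\<close> and the conjugation rule from \<open>\<tau>(a)\<close>. Next, the same \<open>T\<close> embeds
  \<open>\<gamma> = \<pi> \<cdot> \<epsilon>\<^sub>A\<close> into the restriction of \<open>\<tau>\<close> to O(n), again uniquely up to a scalar. Finally,
  uniqueness of the embedding forces the averaged operator that defines the isotypic projection to be
  \<open>T T\<^sup>* / c\<close> with \<open>T\<^sup>* T = c\<close> (lemma \<open>isotypic_proj_eq\<close>). That expression does not see the
  group, so the projections for \<open>\<pi>\<close> and for \<open>\<gamma>\<close> coincide, and with them the spherical functions.

  Multiplicity one follows from commutativity of the algebra of operators that commute with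
  \<open>\<tau>(SO(n))\<close> (lemma \<open>commutant_commutative\<close>), proved by a version of Gelfand's trick. The
  geometric input is that for \<open>n = 2 m\<close> every \<open>g\<close> in SO(n+1) is conjugate to its inverse by an
  element of O(n) of determinant \<open>(- 1)\<^sup>m\<close> (lemma \<open>rotation_conjugate_to_inverse\<close>): split
  the space orthogonally into a line fixed by \<open>g\<close> and \<open>m\<close> planes rotated by \<open>g\<close>, and in each plane reflect
  along a vector orthogonal to the last coordinate vector. The product of these \<open>m\<close> reflections fixes that
  vector and inverts \<open>g\<close>. As the determinant is the same for all \<open>g\<close>, a single operator
  \<open>S = \<tau>(s)\<close>, with \<open>s\<close> in O(n), satisfies \<open>Z\<^sup>* = S Z S\<^sup>*\<close> for every real combination \<open>Z\<close> of the operators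
  \<open>\<tau>(g)\<close> that commutes with \<open>\<tau>(SO(n))\<close>. The left side reverses products and the right side preserves them, so
  such \<open>Z\<close> commute with one another. By Burnside's theorem (lemma \<open>burnside_star_algebra\<close>) and by
  averaging over SO(n), they span the whole commutant over the complex numbers.\<close>


section \<open>Eigenvectors of symmetric operators; reflections\<close>

text \<open>A maximum point of the quadratic form of \<open>f\<close> on the unit sphere of \<open>S\<close> is an eigenvector, because the
  first variation vanishes in all directions of \<open>S\<close> orthogonal to it. The lemma finds the planes
  rotated by an orthogonal matrix and, applied to the underlying real space, eigenvectors of
  Hermitian matrices.\<close>

lemma symmetric_eigenvector_in_subspace:
  fixes f :: "'a::euclidean_space \<Rightarrow> 'a"
  assumes lin: "linear f" and sym: "\<And>x y. f x \<bullet> y = x \<bullet> f y"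
    and S: "subspace S" "S \<noteq> {0}" and inv: "\<And>x. x \<in> S \<Longrightarrow> f x \<in> S"
  obtains x c where "x \<in> S" "norm x = 1" "f x = c *\<^sub>R x"
proof -
  let ?C = "S \<inter> sphere 0 1"
  obtain s where s: "s \<in> S" "s \<noteq> 0"
    using S subspace_0 by blast
  then have "s /\<^sub>R norm s \<in> ?C"
    using S(1) by (simp add: subspace_scale)
  then have ne: "?C \<noteq> {}" by blast
  have comp: "compact ?C"
    using S(1) by (simp add: closed_subspace closed_Int_compact)
  have "continuous_on ?C (\<lambda>x. f x \<bullet> x)"
    by (intro continuous_intros linear_continuous_on)
      (simp add: lin linear_conv_bounded_linear[symmetric])
  then obtain x where x: "x \<in> ?C" and max: "\<And>y. y \<in> ?C \<Longrightarrow> f y \<bullet> y \<le> f x \<bullet> x"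
    using continuous_attains_sup[OF comp ne] by blast
  define c where "c = f x \<bullet> x"
  have nx: "x \<bullet> x = 1" and xS: "x \<in> S" "norm x = 1"
    using x by (auto simp: norm_eq_1)
  have le: "f y \<bullet> y \<le> c * (y \<bullet> y)" if "y \<in> S" for y
  proof (cases "y = 0")
    case True
    then show ?thesis by simp
  next
    case False
    then have "y /\<^sub>R norm y \<in> ?C"
      using that S(1) by (simp add: subspace_scale)
    from max[OF this] have "(f y \<bullet> y) / (norm y)^2 \<le> c"
      using False by (simp add: c_def linear_scale[OF lin] power2_eq_square divide_simps)
    then show ?thesis
      using False by (simp add: divide_le_eq dot_square_norm)
  qed
  have orth: "f x \<bullet> y = 0" if y: "y \<in> S" "x \<bullet> y = 0" for y
  proof (rule ccontr)
    assume nz: "f x \<bullet> y \<noteq> 0"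
    define b where "b = f x \<bullet> y"
    define e where "e = c * (y \<bullet> y) - f y \<bullet> y"
    have quad: "2 * t * b \<le> t^2 * e" for t
    proof -
      have "x + t *\<^sub>R y \<in> S"
        using y xS S(1) by (simp add: subspace_add subspace_scale)
      from le[OF this] show ?thesis
        using y nx sym[of y x] c_def
        by (simp add: linear_add[OF lin] linear_scale[OF lin] inner_add_left inner_add_right
            inner_commute e_def b_def power2_eq_square algebra_simps)
    qed
    have "e \<ge> 0" using le[OF y(1)] by (simp add: e_def)
    \<comment> \<open>for this \<open>t\<close> the linear term exceeds the quadratic one\<close>
    define t where "t = b / (e + 1)"
    have b: "b = t * (e + 1)" using \<open>e \<ge> 0\<close> by (simp add: t_def)
    have "t \<noteq> 0" using nz \<open>e \<ge> 0\<close> by (simp add: t_def b_def)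
    then have "t^2 * (e + 2) > 0" using \<open>e \<ge> 0\<close> by simp
    then show False using quad[of t] by (simp add: b power2_eq_square algebra_simps)
  qed
  define r where "r = f x - c *\<^sub>R x"
  have rS: "r \<in> S" using xS inv S(1) by (simp add: r_def subspace_diff subspace_scale)
  have xr: "x \<bullet> r = 0" by (simp add: r_def inner_diff_right c_def nx inner_commute)
  have "r \<bullet> r = 0"
    using orth[OF rS xr] xr unfolding r_def by (simp add: inner_diff_left)
  then have "f x = c *\<^sub>R x" by (simp add: r_def)
  with xS show thesis using that by blast
qed

lemma orthogonal_refl_mat: "orthogonal_matrix (refl_mat l)"
  by (auto simp: orthogonal_matrix refl_mat_def matrix_matrix_mult_def transpose_def mat_def vec_eq_iff
      if_distrib[of "\<lambda>x. x * _"] if_distrib[of "\<lambda>x. _ * x"] cong: if_cong)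

lemma det_refl_mat: "det (refl_mat l) = - 1"
proof -
  have "det (refl_mat l) = (\<Prod>i\<in>UNIV. refl_mat l $ i $ i)"
    by (rule det_diagonal) (simp add: refl_mat_def)
  also have "\<dots> = (\<Prod>i\<in>UNIV. if i = l then - 1 else 1)"
    by (rule prod.cong) (simp_all add: refl_mat_def)
  finally show ?thesis by simp
qed

lemma refl_mat_mult_vec: "refl_mat l *v x = x - (2 * (x $ l)) *\<^sub>R axis l 1"
  by (auto simp: refl_mat_def matrix_vector_mult_def vec_eq_iff axis_def
     if_distrib[of "\<lambda>x. x * _"] cong: if_cong)

lemma transpose_dot: "(transpose (B :: real ^ 'm ^ 'k) *v x) \<bullet> y = x \<bullet> (B *v y)"
  by (simp add: transpose_matrix_vector dot_lmul_matrix)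

text \<open>Conjugating \<^term>\<open>refl_mat l\<close> by an orthogonal matrix that moves the \<open>l\<close>-th basis vector to \<open>w\<close>
  yields the reflection along \<open>w\<close> together with its determinant.\<close>

lemma reflection_exists:
  fixes w :: "real ^ 'm::finite"
  assumes "norm w = 1"
  obtains R where "orthogonal_matrix R" "det R = - 1"
    "\<And>y. R *v y = y - (2 * (w \<bullet> y)) *\<^sub>R w"
proof -
  fix l :: 'm
  obtain Q where Q: "orthogonal_matrix Q" "Q *v axis l 1 = w"
    using orthogonal_matrix_exists_basis[OF assms] by metis
  let ?R = "Q ** refl_mat l ** transpose Q"
  have "orthogonal_matrix ?R"
    by (intro orthogonal_matrix_mul orthogonal_refl_mat Q) (simp add: Q)
  moreover have "det ?R = - 1"
    using det_orthogonal_matrix[OF Q(1)] by (auto simp: det_mul det_refl_mat)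
  moreover have "?R *v y = y - (2 * (w \<bullet> y)) *\<^sub>R w" for y
  proof -
    have "(transpose Q *v y) $ l = axis l 1 \<bullet> (transpose Q *v y)"
      by (simp add: inner_axis' del: transpose_matrix_vector)
    also have "\<dots> = w \<bullet> y"
      by (subst inner_commute, subst transpose_dot) (simp add: Q(2) inner_commute)
    finally have "?R *v y = (Q ** transpose Q) *v y - (2 * (w \<bullet> y)) *\<^sub>R w"
      by (simp add: matrix_vector_mul_assoc[symmetric] refl_mat_mult_vec matrix_vector_mult_diff_distrib
          matrix_vector_mult_scaleR Q(2))
    then show ?thesis using Q(1) by (simp add: orthogonal_matrix_def)
  qed
  ultimately show thesis using that by blast
qed

lemma orthogonal_matrix_dot:
  "orthogonal_matrix (Q :: real ^ 'm::finite ^ 'm) \<Longrightarrow> (Q *v x) \<bullet> (Q *v y) = x \<bullet> y"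
  by (metis orthogonal_matrix transpose_dot matrix_vector_mul_assoc matrix_vector_mul_lid)

lemma orthogonal_matrix_cancel:
  assumes "orthogonal_matrix (Q :: real ^ 'm::finite ^ 'm)"
  shows "transpose Q *v (Q *v x) = x" "Q *v (transpose Q *v x) = x"
  using assms by (metis orthogonal_matrix_def matrix_vector_mul_assoc matrix_vector_mul_lid)+

section \<open>Inverting a rotation by reflections\<close>

text \<open>An injective map of a finite dimensional space into itself is onto, so \<open>g\<close> maps \<open>S\<close> onto \<open>S\<close> and its
  inverse preserves \<open>S\<close> as well.\<close>

lemma orthogonal_invariant_subspace_transpose:
  fixes g :: "real ^ 'm::finite ^ 'm"
  assumes g: "orthogonal_matrix g" and S: "subspace S" and inv: "\<And>x. x \<in> S \<Longrightarrow> g *v x \<in> S"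
    and x: "x \<in> S"
  shows "transpose g *v x \<in> S"
proof -
  have inj: "inj ((*v) g)"
    by (metis (no_types) g orthogonal_matrix_cancel(1) injI)
  have "dim ((*v) g ` S) = dim S"
    by (rule dim_image_eq) (use inj inj_on_subset in \<open>auto simp: matrix_vector_mul_linear\<close>)
  then have "(*v) g ` S = S"
    by (intro subspace_dim_equal)
      (use S inv in \<open>auto simp: linear_subspace_image matrix_vector_mul_linear\<close>)
  then obtain y where "y \<in> S" "x = g *v y" using x by blast
  then show ?thesis by (simp add: orthogonal_matrix_cancel[OF g] del: transpose_matrix_vector)
qed

lemma orthogonal_complement_invariant:
  fixes g :: "real ^ 'm::finite ^ 'm"
  assumes g: "orthogonal_matrix g" and S: "subspace S" and gS: "\<And>x. x \<in> S \<Longrightarrow> g *v x \<in> S"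
    and P: "subspace P" "P \<subseteq> S" and gP: "\<And>x. x \<in> P \<Longrightarrow> g *v x \<in> P"
  shows "subspace {y \<in> S. \<forall>x\<in>P. orthogonal x y}"
    and "y \<in> {y \<in> S. \<forall>x\<in>P. orthogonal x y} \<Longrightarrow> g *v y \<in> {y \<in> S. \<forall>x\<in>P. orthogonal x y}"
proof -
  show "subspace {y \<in> S. \<forall>x\<in>P. orthogonal x y}"
    using S by (auto simp: subspace_def orthogonal_clauses)
  assume y: "y \<in> {y \<in> S. \<forall>x\<in>P. orthogonal x y}"
  have "orthogonal x (g *v y)" if "x \<in> P" for x
  proof -
    have "transpose g *v x \<in> P"
      by (rule orthogonal_invariant_subspace_transpose[OF g P(1) gP that])
    then show ?thesis
      using y transpose_dot[of g x y] by (auto simp: orthogonal_def)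
  qed
  then show "g *v y \<in> {y \<in> S. \<forall>x\<in>P. orthogonal x y}" using y gS by blast
qed

lemma orthogonal_matrix_minus: "orthogonal_matrix (- Q) \<longleftrightarrow> orthogonal_matrix (Q :: real ^ 'm::finite ^ 'm)"
  by (simp add: orthogonal_matrix_def transpose_def matrix_matrix_mult_def)

lemma matrix_vector_mult_minus_left: "(- A) *v x = - (A *v (x :: real ^ 'm::finite))"
  by (simp add: matrix_vector_mult_def vec_eq_iff sum_negf)

lemma matrix_vector_mult_minus_right: "A *v (- x) = - (A *v (x :: 'a::ring_1 ^ 'm))"
  by (simp add: matrix_vector_mult_def vec_eq_iff sum_negf)

text \<open>\<open>H\<close> conjugates \<open>g\<close> to its inverse on \<open>S\<close> and acts only inside \<open>S\<close>. The equation \<open>g H g = H\<close> is the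
  conjugation rule \<open>H g H\<^sup>-\<^sup>1 = g\<^sup>-\<^sup>1\<close> cleared of inverses.\<close>

definition reverses_on :: "real ^ 'm ^ 'm \<Rightarrow> (real ^ 'm) set \<Rightarrow> real ^ 'm ^ 'm \<Rightarrow> bool" where
  "reverses_on g S H \<longleftrightarrow> orthogonal_matrix H \<and> (\<forall>x\<in>S. H *v x \<in> S \<and> g *v (H *v (g *v x)) = H *v x) \<and>
     (\<forall>x. (\<forall>y\<in>S. y \<bullet> x = 0) \<longrightarrow> H *v x = x)"

text \<open>The two factors act on complementary orthogonal subspaces, both of them invariant under \<open>g\<close>, and each is the
  identity where the other one acts.\<close>

lemma reverses_on_compose:
  fixes g N H :: "real ^ 'm::finite ^ 'm"
  assumes g: "orthogonal_matrix g" and S: "subspace S" and gS: "\<And>x. x \<in> S \<Longrightarrow> g *v x \<in> S"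
    and P: "subspace P" "P \<subseteq> S" and gP: "\<And>x. x \<in> P \<Longrightarrow> g *v x \<in> P"
    and N: "reverses_on g P N" and H: "reverses_on g {y \<in> S. \<forall>x\<in>P. orthogonal x y} H"
  shows "reverses_on g S (N ** H)"
proof -
  let ?Q = "{y \<in> S. \<forall>x\<in>P. orthogonal x y}"
  have No: "orthogonal_matrix N" and NP: "\<And>x. x \<in> P \<Longrightarrow> N *v x \<in> P"
    and Ng: "\<And>x. x \<in> P \<Longrightarrow> g *v (N *v (g *v x)) = N *v x"
    and Nid: "\<And>x. (\<forall>y\<in>P. y \<bullet> x = 0) \<Longrightarrow> N *v x = x"
    using N by (auto simp: reverses_on_def)
  have Ho: "orthogonal_matrix H" and HQ: "\<And>x. x \<in> ?Q \<Longrightarrow> H *v x \<in> ?Q"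
    and Hg: "\<And>x. x \<in> ?Q \<Longrightarrow> g *v (H *v (g *v x)) = H *v x"
    and Hid: "\<And>x. (\<forall>y\<in>?Q. y \<bullet> x = 0) \<Longrightarrow> H *v x = x"
    using H by (auto simp: reverses_on_def)
  have HP: "H *v x = x" if "x \<in> P" for x
    using that by (intro Hid) (auto simp: orthogonal_def inner_commute)
  have NQ: "N *v x = x" if "x \<in> ?Q" for x
    using that by (intro Nid) (auto simp: orthogonal_def)
  have gQ: "g *v y \<in> ?Q" if "y \<in> ?Q" for y
    by (rule orthogonal_complement_invariant(2)[OF g S gS P gP that])
  have "(N ** H) *v x \<in> S \<and> g *v ((N ** H) *v (g *v x)) = (N ** H) *v x" if "x \<in> S" for x
  proof -
    obtain p q where p: "p \<in> span P" and q: "\<And>w. w \<in> span P \<Longrightarrow> orthogonal q w" and x: "x = p + q"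
      using orthogonal_subspace_decomp_exists by metis
    have p: "p \<in> P" using p P(1) span_eq_iff by blast
    have "q = x - p" using x by simp
    then have "q \<in> S" using p P(2) S \<open>x \<in> S\<close> subspace_diff by blast
    then have q: "q \<in> ?Q" using q by (auto simp: span_base orthogonal_commute)
    have "(N ** H) *v x = N *v p + H *v q"
      using HP[OF p] NQ[OF HQ[OF q]]
      by (simp add: x matrix_vector_mul_assoc[symmetric] matrix_vector_right_distrib)
    moreover have "(N ** H) *v (g *v x) = N *v (g *v p) + H *v (g *v q)"
      using HP[OF gP[OF p]] NQ[OF HQ[OF gQ[OF q]]]
      by (simp add: x matrix_vector_mul_assoc[symmetric] matrix_vector_right_distrib)
    moreover have "N *v p + H *v q \<in> S"
      using NP[OF p] HQ[OF q] P(2) S by (auto intro!: subspace_add)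
    ultimately show ?thesis
      using Ng[OF p] Hg[OF q] by (simp add: matrix_vector_right_distrib)
  qed
  moreover have "(N ** H) *v x = x" if "\<forall>y\<in>S. y \<bullet> x = 0" for x
  proof -
    have "H *v x = x" using that by (intro Hid) auto
    moreover have "N *v x = x" using that P(2) by (intro Nid) auto
    ultimately show ?thesis by (simp add: matrix_vector_mul_assoc[symmetric])
  qed
  ultimately show ?thesis
    using No Ho by (simp add: reverses_on_def orthogonal_matrix_mul)
qed

text \<open>The eigenvalue of an orthogonal matrix is 1 or -1, so on an eigenline \<open>g\<close> is its own inverse.\<close>

lemma reverses_on_eigenline:
  assumes "orthogonal_matrix (g :: real ^ 'm::finite ^ 'm)" "g *v w = c *\<^sub>R w"
  shows "reverses_on g (span {w}) (mat 1)"
proof (cases "w = 0")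
  case False
  have "(w \<bullet> w) = c * (c * (w \<bullet> w))"
    using orthogonal_matrix_dot[OF assms(1), of w w] by (simp add: assms(2))
  then have "c * c = 1" using False by simp
  then show ?thesis
    using assms(2) by (auto simp: reverses_on_def orthogonal_matrix_id span_singleton matrix_vector_mult_scaleR)
qed (simp add: reverses_on_def orthogonal_matrix_id)

text \<open>That \<open>w\<close> is an eigenvector of \<open>g + g\<^sup>T\<close> means \<open>g (g w) = c g w - w\<close>: the plane spanned by \<open>w\<close> and \<open>g w\<close> is
  invariant, \<open>g\<close> rotates it, and a reflection of a plane inverts its rotations.\<close>

lemma reverses_on_plane:
  assumes g: "orthogonal_matrix (g :: real ^ 'm::finite ^ 'm)"
    and w: "norm w = 1" "g *v w + transpose g *v w = c *\<^sub>R w"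
    and R: "orthogonal_matrix R" "\<And>y. R *v y = y - (2 * (w \<bullet> y)) *\<^sub>R w"
  shows "reverses_on g (span {w, g *v w}) R" "\<And>x. x \<in> span {w, g *v w} \<Longrightarrow> g *v x \<in> span {w, g *v w}"
proof -
  have gg: "g *v (g *v w) = c *\<^sub>R (g *v w) - w"
    using arg_cong[OF w(2), of "(*v) g"] orthogonal_matrix_cancel[OF g]
    by (simp add: matrix_vector_right_distrib matrix_vector_mult_scaleR algebra_simps del: transpose_matrix_vector)
  have ww: "w \<bullet> w = 1" using w(1) by (simp add: norm_eq_1)
  have "(g *v w) \<bullet> w + (transpose g *v w) \<bullet> w = c"
    using arg_cong[OF w(2), of "\<lambda>y. y \<bullet> w"] ww by (simp add: inner_add_left del: transpose_matrix_vector)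
  then have gw: "2 * (w \<bullet> (g *v w)) = c"
    by (simp only: transpose_dot) (simp add: inner_commute)
  have span: "x \<in> span {w, g *v w} \<longleftrightarrow> (\<exists>a b. x = a *\<^sub>R w + b *\<^sub>R (g *v w))" for x
    by (auto simp: span_insert span_singleton algebra_simps)
  have in_span: "a *\<^sub>R w + b *\<^sub>R (g *v w) \<in> span {w, g *v w}" for a b
    using span by blast
  show g_inv: "g *v x \<in> span {w, g *v w}" if x: "x \<in> span {w, g *v w}" for x
  proof -
    obtain a b where "x = a *\<^sub>R w + b *\<^sub>R (g *v w)" using x span by blast
    then have "g *v x = (- b) *\<^sub>R w + (a + b * c) *\<^sub>R (g *v w)"
      by (simp add: matrix_vector_right_distrib matrix_vector_mult_scaleR gg algebra_simps)
    then show ?thesis using in_span by metis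
  qed
  have Rw: "R *v w = - w" by (simp add: R(2) ww scaleR_2)
  have Rgw: "R *v (g *v w) = g *v w - c *\<^sub>R w" by (simp add: R(2) gw)
  have "R *v x \<in> span {w, g *v w} \<and> g *v (R *v (g *v x)) = R *v x" if x: "x \<in> span {w, g *v w}" for x
  proof -
    obtain a b where x: "x = a *\<^sub>R w + b *\<^sub>R (g *v w)" using x span by blast
    have "R *v x = (- a - b * c) *\<^sub>R w + b *\<^sub>R (g *v w)"
      by (simp add: x matrix_vector_right_distrib matrix_vector_mult_scaleR Rw Rgw algebra_simps)
    moreover have "g *v (R *v (g *v x)) = R *v x"
      by (simp add: x matrix_vector_right_distrib matrix_vector_mult_diff_distrib matrix_vector_mult_scaleR
          gg Rw Rgw algebra_simps)
    ultimately show ?thesis using in_span by metis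
  qed
  moreover have "R *v x = x" if "\<forall>y\<in>span {w, g *v w}. y \<bullet> x = 0" for x
    using that by (simp add: R(2) span_base)
  ultimately show "reverses_on g (span {w, g *v w}) R"
    using R(1) by (simp add: reverses_on_def)
qed


text \<open>Split off from \<open>S\<close> an eigenline, with the identity, or a rotated plane, with a reflection of that plane, and
  continue in the orthogonal complement. The plane leaves room to choose the reflecting vector orthogonal to
  the prescribed \<open>v\<close>, so that the product fixes \<open>v\<close>. If \<open>g\<close> has no eigenvector in \<open>S\<close>, only planes
  occur, and the number of reflections is half the dimension.\<close>

lemma reverser_exists:
  fixes g :: "real ^ 'm::finite ^ 'm"
  assumes g: "orthogonal_matrix g" and S: "subspace S" and inv: "\<And>x. x \<in> S \<Longrightarrow> g *v x \<in> S"
  shows "\<exists>H. reverses_on g S H \<and> H *v v = v \<and>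
    ((\<forall>x\<in>S. x \<noteq> 0 \<longrightarrow> (\<forall>c. g *v x \<noteq> c *\<^sub>R x)) \<longrightarrow> even (dim S) \<and> det H = (- 1) ^ (dim S div 2))"
  using S inv
proof (induction "dim S" arbitrary: S rule: less_induct)
  case less
  note S = less.prems(1) and gS = less.prems(2)
  show ?case
  proof (cases "S = {0}")
    case True
    then show ?thesis
      by (intro exI[of _ "mat 1"]) (simp add: reverses_on_def orthogonal_matrix_id)
  next
    case False
    define f where "f x = g *v x + transpose g *v x" for x
    have linf: "linear f"
      unfolding f_def by (intro linear_compose_add matrix_vector_mul_linear)
    have symf: "f x \<bullet> y = x \<bullet> f y" for x y
      using transpose_dot[of g x y] transpose_dot[of g y x]
      by (simp add: f_def inner_add_left inner_add_right inner_commute del: transpose_matrix_vector)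
    have fS: "f x \<in> S" if "x \<in> S" for x
      using gS[OF that] orthogonal_invariant_subspace_transpose[OF g S gS that] S
      by (simp add: f_def subspace_add del: transpose_matrix_vector)
    obtain x c where x: "x \<in> S" "norm x = 1" "f x = c *\<^sub>R x"
      using symmetric_eigenvector_in_subspace[OF linf symf S False fS] by metis
    show ?thesis
    proof (cases "\<exists>a. g *v x = a *\<^sub>R x")
      case True
      then obtain a where a: "g *v x = a *\<^sub>R x" by blast
      let ?P = "span {x}" and ?Q = "{y \<in> S. \<forall>z\<in>span {x}. orthogonal z y}"
      have P: "subspace ?P" "?P \<subseteq> S" using x S by (auto simp: span_minimal)
      have gP: "g *v y \<in> ?P" if "y \<in> ?P" for y
        using that by (auto simp: span_singleton a matrix_vector_mult_scaleR)
      have Q: "subspace ?Q" "\<And>y. y \<in> ?Q \<Longrightarrow> g *v y \<in> ?Q"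
        using orthogonal_complement_invariant[OF g S gS P gP] by auto
      have "dim ?P > 0"
        using x(2) by (metis dim_eq_0 gr0I insert_subset norm_zero singletonD span_base subsetD insertI1 zero_neq_one)
      then have "dim ?Q < dim S"
        using dim_subspace_orthogonal_to_vectors[OF P(1) S P(2)] by linarith
      from less.hyps[OF this Q] obtain H where "reverses_on g ?Q H" "H *v v = v" by blast
      then have "reverses_on g S (mat 1 ** H)" "H *v v = v"
        using reverses_on_compose[OF g S gS P gP reverses_on_eigenline[OF g a]] by auto
      moreover have "x \<noteq> 0" using x(2) by auto
      ultimately show ?thesis using x(1) a by auto
    next
      case False
      \<comment> \<open>every vector of the plane of \<open>x\<close> and \<open>g x\<close> is an eigenvector of \<open>f\<close>; \<open>u\<close> is one orthogonal to \<open>v\<close>\<close>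
      define u where "u = (if x \<bullet> v = 0 then x else ((g *v x) \<bullet> v) *\<^sub>R x - (x \<bullet> v) *\<^sub>R (g *v x))"
      have "u \<noteq> 0"
      proof
        assume u: "u = 0"
        show False
        proof (cases "x \<bullet> v = 0")
          case True
          then show False using u x(2) by (simp add: u_def)
        next
          case nz: False
          then have "g *v x = (((g *v x) \<bullet> v) / (x \<bullet> v)) *\<^sub>R x"
            using u by (simp add: u_def vec_eq_iff field_simps)
          then show False using False by blast
        qed
      qed
      have uv: "u \<bullet> v = 0" by (simp add: u_def inner_diff_left)
      have uS: "u \<in> S" using x(1) gS S by (simp add: u_def subspace_diff subspace_scale)
      have "f (g *v x) = g *v f x"
        using orthogonal_matrix_cancel[OF g] by (simp add: f_def matrix_vector_right_distrib del: transpose_matrix_vector)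
      then have "f (g *v x) = c *\<^sub>R (g *v x)" by (simp add: x(3) matrix_vector_mult_scaleR)
      then have fu: "f u = c *\<^sub>R u"
        using x(3) by (simp add: u_def linear_diff[OF linf] linear_scale[OF linf] algebra_simps)
      define w where "w = u /\<^sub>R norm u"
      have w: "norm w = 1" "w \<bullet> v = 0" "w \<in> S" "f w = c *\<^sub>R w"
        using \<open>u \<noteq> 0\<close> uv uS S fu by (auto simp: w_def subspace_scale linear_scale[OF linf])
      obtain R where R: "orthogonal_matrix R" "det R = - 1" "\<And>y. R *v y = y - (2 * (w \<bullet> y)) *\<^sub>R w"
        using reflection_exists[OF w(1)] by metis
      let ?P = "span {w, g *v w}" and ?Q = "{y \<in> S. \<forall>z\<in>span {w, g *v w}. orthogonal z y}"
      have P: "subspace ?P" "?P \<subseteq> S" using w S gS span_minimal[of "{w, g *v w}" S] by auto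
      note plane = reverses_on_plane[OF g w(1) w(4)[unfolded f_def] R(1,3)]
      have Q: "subspace ?Q" "\<And>y. y \<in> ?Q \<Longrightarrow> g *v y \<in> ?Q"
        using orthogonal_complement_invariant[OF g S gS P plane(2)] by auto
      have "w \<noteq> 0" using w(1) by auto
      have "dim ?P > 0"
        using \<open>w \<noteq> 0\<close> by (metis dim_eq_0 gr0I singletonD span_base subsetD insertI1)
      moreover note dimS = dim_subspace_orthogonal_to_vectors[OF P(1) S P(2)]
      ultimately have "dim ?Q < dim S" by linarith
      from less.hyps[OF this Q] obtain H where H: "reverses_on g ?Q H" "H *v v = v"
        "(\<forall>x\<in>?Q. x \<noteq> 0 \<longrightarrow> (\<forall>c. g *v x \<noteq> c *\<^sub>R x)) \<Longrightarrow> even (dim ?Q) \<and> det H = (- 1) ^ (dim ?Q div 2)" by blast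
      have "reverses_on g S (R ** H)"
        using reverses_on_compose[OF g S gS P plane(2,1) H(1)] by auto
      moreover have "(R ** H) *v v = v"
        by (simp add: matrix_vector_mul_assoc[symmetric] H(2) R(3) w(2))
      moreover have "even (dim S) \<and> det (R ** H) = (- 1) ^ (dim S div 2)"
        if noeig: "\<forall>x\<in>S. x \<noteq> 0 \<longrightarrow> (\<forall>c. g *v x \<noteq> c *\<^sub>R x)"
      proof -
        have "g *v w \<noteq> w" using noeig w(3) \<open>w \<noteq> 0\<close> by (metis scaleR_one)
        moreover have "g *v w \<notin> span {w}"
          using noeig w(3) \<open>w \<noteq> 0\<close> by (auto simp: span_singleton)
        ultimately have "independent {g *v w, w}" "card {g *v w, w} = 2"
          using \<open>w \<noteq> 0\<close> by (auto simp: independent_insert)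
        then have "dim ?P = 2"
          by (metis dim_span_eq_card_independent insert_commute)
        then have "dim S = Suc (Suc (dim ?Q))" using dimS by linarith
        moreover have "even (dim ?Q) \<and> det H = (- 1) ^ (dim ?Q div 2)"
          using H(3) noeig by blast
        ultimately show ?thesis by (simp add: det_mul R(2))
      qed
      ultimately show ?thesis by blast
    qed
  qed
qed

lemma orthogonal_eigenvector_transpose:
  assumes "orthogonal_matrix (g :: real ^ 'm::finite ^ 'm)" "g *v x = c *\<^sub>R x" "x \<noteq> 0"
  shows "c = 1 \<or> c = - 1" "transpose g *v x = c *\<^sub>R x"
proof -
  have "x \<bullet> x = c * (c * (x \<bullet> x))"
    using orthogonal_matrix_dot[OF assms(1), of x x] by (simp add: assms(2))
  then have cc: "c * c = 1" using assms(3) by simp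
  then show "c = 1 \<or> c = - 1" by (simp add: square_eq_1_iff)
  have "x = c *\<^sub>R (transpose g *v x)"
    using arg_cong[OF assms(2), of "(*v) (transpose g)"] orthogonal_matrix_cancel[OF assms(1)]
    by (simp add: matrix_vector_mult_scaleR del: transpose_matrix_vector)
  then have "c *\<^sub>R x = (c * c) *\<^sub>R (transpose g *v x)"
    by (metis scaleR_scaleR)
  then show "transpose g *v x = c *\<^sub>R x" using cc by simp
qed

lemma det_uminus: "det (- A :: real ^ 'm::finite ^ 'm) = (- 1) ^ CARD('m) * det A"
proof -
  have "- A = matrix ((*\<^sub>R) (- 1)) ** A"
    by (simp add: matrix_def vec_eq_iff matrix_matrix_mult_def axis_def sum_negf if_distrib[of "\<lambda>x. x * _"] cong: if_cong)
  then show ?thesis by (metis det_mul det_matrix_scaleR)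
qed

text \<open>In odd dimension \<open>det (g - 1) = det (g (1 - g\<^sup>T)) = det (1 - g) = - det (g - 1)\<close>.\<close>

lemma rotation_fixed_vector:
  assumes odd: "odd CARD('m::finite)" and g: "orthogonal_matrix (g :: real ^ 'm ^ 'm)" "det g = 1"
  obtains u where "u \<noteq> 0" "g *v u = u"
proof -
  have "g ** (mat 1 - transpose g) = g - mat 1"
    using orthogonal_matrix_cancel(2)[OF g(1)]
    by (simp add: matrix_eq matrix_vector_mul_assoc[symmetric] matrix_vector_mult_diff_rdistrib
        matrix_vector_mult_diff_distrib del: transpose_matrix_vector)
  then have "det (g - mat 1) = det (mat 1 - transpose g)"
    by (metis det_mul g(2) mult_1)
  also have "\<dots> = det (transpose (mat 1 - g))"
    by (rule arg_cong[of _ _ det]) (auto simp: transpose_def mat_def vec_eq_iff)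
  also have "\<dots> = det (- (g - mat 1))" by simp
  also have "\<dots> = - det (g - mat 1)" using odd by (simp only: det_uminus) simp
  finally have "\<not> invertible (g - mat 1)" by (simp add: invertible_det_nz)
  then obtain u where "u \<noteq> 0" "(g - mat 1) *v u = 0"
    by (meson invertible_left_inverse matrix_left_invertible_ker)
  then show thesis using that by (simp add: matrix_vector_mult_diff_rdistrib)
qed

text \<open>If some eigenvector \<open>w\<close> of \<open>g\<close> is orthogonal to \<open>v\<close>, the reflection along \<open>w\<close> commutes with \<open>g\<close> and fixes \<open>v\<close>, so
  multiplying a reverser by it corrects the sign of the determinant. Otherwise each eigenspace meets the
  hyperplane orthogonal to \<open>v\<close> only in 0, so every nonzero eigenspace is a line. One of them is the line of vectors
  fixed by \<open>g\<close>, and eigenvalue -1 does not occur, because \<open>det g = 1\<close> makes its multiplicity even. Hence the complement of the fixed line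
  contains no eigenvector and consists of \<open>m\<close> rotated planes.\<close>

lemma rotation_reverser:
  fixes g :: "real ^ 'm::finite ^ 'm"
  assumes card: "CARD('m) = 2 * m + 1" and g: "orthogonal_matrix g" "det g = 1"
  obtains H where "orthogonal_matrix H" "det H = (- 1) ^ m" "H *v v = v" "H ** g = transpose g ** H"
proof -
  have odd: "odd CARD('m)" using card by simp
  have fin: "H ** g = transpose g ** H" if "\<And>x. g *v (H *v (g *v x)) = H *v x" for H
  proof -
    have "(H ** g) *v x = (transpose g ** H) *v x" for x
      using orthogonal_matrix_cancel(1)[OF g(1), of "H *v (g *v x)"]
      by (simp add: that matrix_vector_mul_assoc[symmetric] del: transpose_matrix_vector)
    then show ?thesis by (simp add: matrix_eq)
  qed
  show thesis
  proof (cases "\<exists>w c. w \<noteq> 0 \<and> w \<bullet> v = 0 \<and> g *v w = c *\<^sub>R w")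
    case True
    then obtain w0 c where w0: "w0 \<noteq> 0" "w0 \<bullet> v = 0" "g *v w0 = c *\<^sub>R w0" by blast
    define w where "w = w0 /\<^sub>R norm w0"
    have w: "norm w = 1" "w \<bullet> v = 0" "g *v w = c *\<^sub>R w" "w \<noteq> 0"
      using w0 by (auto simp: w_def matrix_vector_mult_scaleR)
    obtain R where R: "orthogonal_matrix R" "det R = - 1" "\<And>y. R *v y = y - (2 * (w \<bullet> y)) *\<^sub>R w"
      using reflection_exists[OF w(1)] by metis
    have "R *v (g *v x) = g *v (R *v x)" for x
    proof -
      have "w \<bullet> (g *v x) = c * (w \<bullet> x)"
        using transpose_dot[of g w x] orthogonal_eigenvector_transpose(2)[OF g(1) w(3,4)] by simp
      then show ?thesis
        by (simp add: R(3) matrix_vector_mult_diff_distrib matrix_vector_mult_scaleR w(3) mult_ac)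
    qed
    then have Rg: "R ** g = g ** R" by (simp add: matrix_eq matrix_vector_mul_assoc[symmetric])
    have Rv: "R *v v = v" by (simp add: R(3) w(2))
    obtain H where H: "reverses_on g UNIV H" "H *v v = v"
      using reverser_exists[OF g(1) subspace_UNIV] by auto
    then have Ho: "orthogonal_matrix H" and Hg: "H ** g = transpose g ** H"
      using fin by (auto simp: reverses_on_def)
    have "(H ** R) ** g = transpose g ** (H ** R)"
      by (metis Hg Rg matrix_mul_assoc)
    moreover have "orthogonal_matrix (H ** R)" using Ho R(1) by (rule orthogonal_matrix_mul)
    moreover have "(H ** R) *v v = v" by (simp add: matrix_vector_mul_assoc[symmetric] H(2) Rv)
    moreover have "det (H ** R) = - det H" by (simp add: det_mul R(2))
    ultimately show thesis
      using that Ho Hg H(2) det_orthogonal_matrix[OF Ho]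
      by (cases "det H = (- 1) ^ m") (auto simp: uminus_power_if split: if_splits)
  next
    case False
    then have none: "\<And>w c. w \<noteq> 0 \<Longrightarrow> g *v w = c *\<^sub>R w \<Longrightarrow> w \<bullet> v \<noteq> 0" by blast
    have unique: "\<exists>a. y = a *\<^sub>R x" if "x \<noteq> 0" "g *v x = c *\<^sub>R x" "g *v y = c *\<^sub>R y" for x y c
    proof -
      let ?z = "(x \<bullet> v) *\<^sub>R y - (y \<bullet> v) *\<^sub>R x"
      have "g *v ?z = c *\<^sub>R ?z"
        by (simp add: matrix_vector_mult_diff_distrib matrix_vector_mult_scaleR that algebra_simps)
      moreover have "?z \<bullet> v = 0" by (simp add: inner_diff_left)
      ultimately have "?z = 0" using none by blast
      moreover have "x \<bullet> v \<noteq> 0" using none that by blast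
      ultimately have "y = ((y \<bullet> v) / (x \<bullet> v)) *\<^sub>R x"
        by (simp add: vec_eq_iff field_simps)
      then show ?thesis by blast
    qed
    obtain u where u: "u \<noteq> 0" "g *v u = u" using rotation_fixed_vector[OF odd g] by blast
    let ?P = "span {u}" and ?S = "{y \<in> UNIV. \<forall>x\<in>span {u}. orthogonal x y}"
    have gP: "g *v y \<in> ?P" if "y \<in> ?P" for y
      using that by (auto simp: span_singleton u matrix_vector_mult_scaleR)
    have S: "subspace ?S" "\<And>y. y \<in> ?S \<Longrightarrow> g *v y \<in> ?S"
      using orthogonal_complement_invariant[OF g(1) subspace_UNIV _ subspace_span _ gP] by auto
    have "dim ?P = 1" using u(1) by (simp add: dim_span_eq_card_independent)
    then have dimS: "dim ?S = 2 * m"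
      using dim_subspace_orthogonal_to_vectors[OF subspace_span subspace_UNIV, of "{u}"] card by simp
    have noeig: "g *v x \<noteq> c *\<^sub>R x" if x: "x \<in> ?S" "x \<noteq> 0" for x c
    proof
      assume gx: "g *v x = c *\<^sub>R x"
      have ux: "u \<bullet> x = 0" using x(1) by (simp add: span_base orthogonal_def)
      consider "c = 1" | "c = - 1" using orthogonal_eigenvector_transpose(1)[OF g(1) gx x(2)] by blast
      then show False
      proof cases
        case 1
        then obtain a where "x = a *\<^sub>R u" using unique[of u 1 x] u gx by auto
        then show False using ux u(1) x(2) by auto
      next
        case 2
        define w where "w = x /\<^sub>R norm x"
        have w: "norm w = 1" "g *v w = (- 1) *\<^sub>R w" "w \<noteq> 0"
          using x(2) gx 2 by (auto simp: w_def matrix_vector_mult_scaleR)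
        obtain R where R: "orthogonal_matrix R" "det R = - 1" "\<And>y. R *v y = y - (2 * (w \<bullet> y)) *\<^sub>R w"
          using reflection_exists[OF w(1)] by metis
        \<comment> \<open>\<open>- R g\<close> is a rotation; a vector fixed by it is a second eigenvector of \<open>g\<close> for -1\<close>
        have "orthogonal_matrix (- (R ** g))"
          using orthogonal_matrix_mul[OF R(1) g(1)] by (simp add: orthogonal_matrix_minus)
        moreover have "det (- (R ** g)) = 1" using odd by (simp add: det_uminus det_mul R(2) g(2))
        ultimately obtain y where y: "y \<noteq> 0" "- (R ** g) *v y = y"
          using rotation_fixed_vector[OF odd] by blast
        have "R *v (g *v y) = - y"
          using y(2) by (metis matrix_vector_mul_assoc matrix_vector_mult_minus_left minus_equation_iff)
        then have eq: "g *v y - (2 * (w \<bullet> (g *v y))) *\<^sub>R w = - y" by (simp add: R(3))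
        have "w \<bullet> (g *v y) = - (w \<bullet> y)"
          using transpose_dot[of g w y] orthogonal_eigenvector_transpose(2)[OF g(1) w(2,3)] by simp
        then have "- (w \<bullet> y) + 2 * (w \<bullet> y) * (w \<bullet> w) = - (w \<bullet> y)"
          using arg_cong[OF eq, of "\<lambda>z. w \<bullet> z"] by (simp add: inner_diff_right inner_add_right)
        then have wy: "w \<bullet> y = 0" using w(3) by simp
        then have "g *v y = (- 1) *\<^sub>R y"
          using eq \<open>w \<bullet> (g *v y) = - (w \<bullet> y)\<close> by simp
        then obtain a where "y = a *\<^sub>R w" using unique[OF w(3,2)] by blast
        then show False using wy y(1) w(3) by auto
      qed
    qed
    obtain H where H: "reverses_on g ?S H" "H *v v = v" "det H = (- 1) ^ m"
      using reverser_exists[OF g(1) S, of v] noeig dimS by auto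
    have "reverses_on g UNIV (mat 1 ** H)"
      by (rule reverses_on_compose[OF g(1) subspace_UNIV _ subspace_span _ gP reverses_on_eigenline[OF g(1), of u 1]])
        (use u H(1) in auto)
    then have "H ** g = transpose g ** H" "orthogonal_matrix H"
      using fin by (auto simp: reverses_on_def)
    then show thesis using that H by blast
  qed
qed


section \<open>Block matrices and the embedding of O(n)\<close>

text \<open>A reverser that fixes the last coordinate vector has corner entry 1 whatever its determinant, so it need not
  have the form \<^term>\<open>embO k\<close>; hence a corner entry independent of \<open>k\<close>.\<close>

definition block_diag :: "real ^ 'n ^ 'n \<Rightarrow> real \<Rightarrow> real ^ ('n option) ^ ('n option)" where
  "block_diag k c = (\<chi> i j. case (i, j) of
       (Some r, Some s) \<Rightarrow> k $ r $ s
     | (None, None) \<Rightarrow> c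
     | _ \<Rightarrow> 0)"

lemma embO_block_diag: "embO k = block_diag k (det k)"
  by (simp add: embO_def block_diag_def)

lemma block_diag_nth [simp]:
  "block_diag k c $ Some r $ Some s = k $ r $ s" "block_diag k c $ None $ None = c"
  "block_diag k c $ Some r $ None = 0" "block_diag k c $ None $ Some s = 0"
  by (simp_all add: block_diag_def)

lemma option_matrix_eq_iff:
  "A = (B :: 'a ^ ('n::finite option) ^ ('n option)) \<longleftrightarrow>
    (\<forall>r s. A $ Some r $ Some s = B $ Some r $ Some s) \<and> (\<forall>r. A $ Some r $ None = B $ Some r $ None) \<and>
    (\<forall>s. A $ None $ Some s = B $ None $ Some s) \<and> A $ None $ None = B $ None $ None"
  by (simp add: vec_eq_iff split_option_all) blast

lemma sum_UNIV_option:
  "(\<Sum>x\<in>UNIV. f x) = f None + (\<Sum>x\<in>UNIV. f (Some (x :: 'n::finite)))" for f :: "_ \<Rightarrow> 'a::comm_monoid_add"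
  by (simp add: UNIV_option_conv sum.reindex o_def)

lemma prod_UNIV_option:
  "(\<Prod>x\<in>UNIV. f x) = f None * (\<Prod>x\<in>UNIV. f (Some (x :: 'n::finite)))" for f :: "_ \<Rightarrow> 'a::comm_monoid_mult"
  by (simp add: UNIV_option_conv prod.reindex o_def)

lemma block_diag_mult: "block_diag k c ** block_diag h d = block_diag (k ** h) (c * d)"
  by (simp add: option_matrix_eq_iff matrix_matrix_mult_def sum_UNIV_option)

lemma block_diag_transpose: "transpose (block_diag k c) = block_diag (transpose k) c"
  by (simp add: option_matrix_eq_iff transpose_def)

lemma block_diag_mat: "block_diag (mat c) c = mat c"
  by (simp add: option_matrix_eq_iff mat_def)

lemma block_diag_minus: "- block_diag k c = block_diag (- k) (- c)"
  by (simp add: option_matrix_eq_iff)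

lemma block_diag_inject: "block_diag k c = block_diag h d \<longleftrightarrow> k = h \<and> c = d"
  by (auto simp: option_matrix_eq_iff vec_eq_iff)

text \<open>Only permutations that fix \<^term>\<open>None\<close> contribute to the determinant, and they correspond to the permutations of
  the remaining indices with the same sign.\<close>

lemma det_block_diag: "det (block_diag k c) = c * det (k :: real ^ 'n::finite ^ 'n)"
proof -
  let ?B = "block_diag k c"
  let ?t = "\<lambda>p. of_int (sign p) * (\<Prod>i\<in>UNIV. ?B $ i $ p i)"
  let ?U = "range (Some :: 'n \<Rightarrow> 'n option)"
  have fixed: "p None = None" if "p permutes ?U" for p
    using that by (auto simp: permutes_def)
  have "det ?B = (\<Sum>p\<in>{p. p permutes UNIV}. ?t p)"
    by (simp add: det_def)
  also have "\<dots> = (\<Sum>p\<in>{p. p permutes ?U}. ?t p)"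
  proof (rule sum.mono_neutral_right)
    show "finite {p. p permutes (UNIV :: 'n option set)}" by (rule finite_permutations) simp
    show "{p. p permutes ?U} \<subseteq> {p. p permutes UNIV}" by (auto intro: permutes_subset)
    show "\<forall>p\<in>{p. p permutes UNIV} - {p. p permutes ?U}. ?t p = 0"
    proof
      fix p assume p: "p \<in> {p. p permutes (UNIV :: 'n option set)} - {p. p permutes ?U}"
      have "p None \<noteq> None"
      proof
        assume "p None = None"
        then have "p permutes ?U"
          using p by (auto simp: permutes_def) (metis option.exhaust rangeI)
        then show False using p by blast
      qed
      then show "?t p = 0" by (auto simp: prod_UNIV_option)
    qed
  qed
  also have "\<dots> = (\<Sum>q\<in>{q. q permutes UNIV}. ?t (map_permutation UNIV Some q))"
    by (rule sum.reindex_bij_betw[symmetric]) (use bij_betw_permutations[of Some UNIV ?U] in \<open>simp add: map_permutation_def bij_betw_def restrict_id_def\<close>)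
  also have "\<dots> = (\<Sum>q\<in>{q. q permutes UNIV}. c * (of_int (sign q) * (\<Prod>i\<in>UNIV. k $ i $ q i)))"
  proof (rule sum.cong[OF refl])
    fix q assume "q \<in> {q. q permutes (UNIV :: 'n set)}"
    then have q: "q permutes (UNIV :: 'n set)" by simp
    have "map_permutation UNIV Some q permutes ?U"
      using map_permutation_permutes[OF _ q, of Some ?U] by (simp add: bij_betw_def)
    then have "map_permutation UNIV Some q None = None" by (rule fixed)
    moreover have "map_permutation UNIV Some q (Some x) = Some (q x)" for x
      by (rule map_permutation_apply) auto
    moreover have "sign (map_permutation UNIV Some q) = sign q"
      by (rule sign_map_permutation[OF _ q]) auto
    ultimately show "?t (map_permutation UNIV Some q) = c * (of_int (sign q) * (\<Prod>i\<in>UNIV. k $ i $ q i))"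
      by (simp add: prod_UNIV_option)
  qed
  finally show ?thesis by (simp add: det_def sum_distrib_left)
qed

lemma SO_subset_O: "SO_grp \<subseteq> O_grp"
  by (auto simp: O_grp_def SO_grp_def rotation_matrix_def)

lemma embO_mult: "embO (k ** h) = embO k ** embO h"
  by (simp add: embO_block_diag block_diag_mult det_mul)

lemma embO_one: "embO (mat 1) = mat 1"
  by (simp add: embO_block_diag block_diag_mat)

lemma embO_transpose: "embO (transpose k) = transpose (embO k)"
  by (simp add: embO_block_diag block_diag_transpose)

lemma embO_in_SO:
  assumes "k \<in> O_grp"
  shows "embO k \<in> SO_grp"
proof -
  have k: "orthogonal_matrix k" using assms by (simp add: O_grp_def)
  then have "transpose (embO k) ** embO k = mat 1"
    by (simp add: embO_transpose[symmetric] embO_mult[symmetric] orthogonal_matrix embO_one)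
  moreover have "det (embO k) = 1"
    using det_orthogonal_matrix[OF k] by (auto simp: embO_block_diag det_block_diag)
  ultimately show ?thesis by (simp add: SO_grp_def rotation_matrix_def orthogonal_matrix)
qed

lemma orthogonal_fixing_None_block_diag:
  assumes H: "orthogonal_matrix H" "H *v axis None 1 = axis None 1"
  obtains k :: "real ^ 'n::finite ^ 'n" where "orthogonal_matrix k" "H = block_diag k 1"
proof -
  have Ht: "transpose H *v axis None 1 = axis None 1"
    using orthogonal_matrix_cancel(1)[OF H(1), of "axis None 1"] by (simp only: H(2))
  have col: "H $ i $ None = (if i = None then 1 else 0)" for i
    using arg_cong[OF H(2)[unfolded matrix_vector_mult_basis], of "\<lambda>x. x $ i"]
    by (simp add: column_def axis_def)
  have row: "H $ None $ i = (if i = None then 1 else 0)" for i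
    using arg_cong[OF Ht[unfolded matrix_vector_mult_basis], of "\<lambda>x. x $ i"]
    by (simp add: column_def axis_def transpose_def)
  define k where "k = (\<chi> r s. H $ Some r $ Some s)"
  have Hk: "H = block_diag k 1"
    by (simp add: option_matrix_eq_iff k_def col row)
  have "block_diag (transpose k ** k) 1 = block_diag (mat 1) 1"
    using H(1) by (simp add: Hk orthogonal_matrix block_diag_transpose block_diag_mult block_diag_mat)
  then have "orthogonal_matrix k" by (simp add: block_diag_inject orthogonal_matrix)
  then show thesis using that Hk by blast
qed

text \<open>For even \<open>m\<close> the reverser of \<open>g\<close> that fixes the last vector lies in the image of O(n). For odd \<open>m\<close> its negative
  does: it conjugates \<open>g\<close> in the same way, its corner entry is -1, and since n is even, the sign change does not affect
  the determinant of the n by n block.\<close>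

lemma rotation_conjugate_to_inverse:
  fixes g :: "real ^ ('n::finite option) ^ ('n option)"
  assumes card: "CARD('n) = 2 * m" and g: "g \<in> SO_grp"
  obtains k :: "real ^ 'n ^ 'n" where "k \<in> O_grp" "det k = (- 1) ^ m" "embO k ** g = transpose g ** embO k"
proof -
  have "CARD('n option) = 2 * m + 1" using card by simp
  moreover have "orthogonal_matrix g" "det g = 1" using g by (simp_all add: SO_grp_def rotation_matrix_def)
  ultimately obtain H where H: "orthogonal_matrix H" "det H = (- 1) ^ m"
    "H *v axis None 1 = axis None 1" "H ** g = transpose g ** H"
    by (rule rotation_reverser)
  obtain k where k: "orthogonal_matrix k" "H = block_diag k 1"
    using orthogonal_fixing_None_block_diag[OF H(1,3)] by blast
  have det: "det k = (- 1) ^ m" using H(2) by (simp add: k(2) det_block_diag)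
  show thesis
  proof (cases "even m")
    case True
    then have "embO k = H" using det by (simp add: embO_block_diag k(2))
    then show thesis using that[of k] k(1) det H(4) by (simp add: O_grp_def)
  next
    case False
    have det': "det (- k) = (- 1) ^ m" using card det by (simp add: det_uminus)
    then have emb: "embO (- k) = - H" using False by (simp add: embO_block_diag k(2) block_diag_minus)
    have "- H ** g = transpose g ** - H"
      using H(4) by (simp add: matrix_eq matrix_vector_mul_assoc[symmetric] matrix_vector_mult_minus_left
          matrix_vector_mult_minus_right del: transpose_matrix_vector)
    then show thesis using that[of "- k"] k(1) det' emb by (simp add: O_grp_def orthogonal_matrix_minus)
  qed
qed

section \<open>Complex matrices and their adjoints\<close>

lemma mat_mult_nth [simp]: "(mat c ** X) $ i $ j = c * X $ i $ j"
  for X :: "'a::comm_semiring_1 ^ 'n ^ 'm::finite"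
  by (simp add: matrix_matrix_mult_def mat_def if_distrib[of "\<lambda>x. x * _"] cong: if_cong)

lemma mult_mat_nth [simp]: "(X ** mat c) $ i $ j = c * X $ i $ j"
  for X :: "'a::comm_semiring_1 ^ 'n::finite ^ 'm"
  by (simp add: matrix_matrix_mult_def mat_def if_distrib[of "\<lambda>x. _ * x"] mult.commute cong: if_cong)

lemma mat_mult_vec [simp]: "mat c *v x = c *s x" for x :: "'a::comm_semiring_1 ^ 'n::finite"
  by (simp add: matrix_vector_mult_def mat_def vec_eq_iff if_distrib[of "\<lambda>x. x * _"] cong: if_cong)

lemma mat_commute: "X ** mat c = mat c ** X" for X :: "'a::comm_semiring_1 ^ 'n::finite ^ 'm::finite"
  by (simp add: vec_eq_iff)

lemma mat_mult_assoc: "X ** (mat c ** Y) = mat c ** (X ** Y)"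
  for X :: "'a::comm_semiring_1 ^ 'n::finite ^ 'm::finite" and Y :: "'a ^ 'k::finite ^ 'n"
  by (metis mat_commute matrix_mul_assoc)

lemma mat_mult_mat: "mat a ** mat b = (mat (a * b) :: 'a::comm_semiring_1 ^ 'n::finite ^ 'n)"
  by (simp add: vec_eq_iff) (simp add: mat_def mult.commute)

lemma mat_mult_mat_mult: "mat a ** (mat b ** X) = mat (a * b) ** X"
  for X :: "'a::comm_semiring_1 ^ 'n::finite ^ 'm::finite"
  by (simp add: matrix_mul_assoc mat_mult_mat)

lemma conj_transpose_nth [simp]: "conj_transpose B $ i $ j = cnj (B $ j $ i)"
  by (simp add: conj_transpose_def)

lemma conj_transpose_conj_transpose [simp]: "conj_transpose (conj_transpose B) = B"
  by (simp add: vec_eq_iff)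

lemma conj_transpose_add: "conj_transpose (A + B) = conj_transpose A + conj_transpose B"
  by (simp add: vec_eq_iff)

lemma conj_transpose_scaleR: "conj_transpose (r *\<^sub>R A) = r *\<^sub>R conj_transpose A"
  by (simp add: vec_eq_iff)

lemma conj_transpose_mult: "conj_transpose (A ** B) = conj_transpose B ** conj_transpose A"
  for A :: "complex ^ 'n::finite ^ 'm"
  by (simp add: vec_eq_iff matrix_matrix_mult_def mult.commute)

lemma conj_transpose_mat [simp]: "conj_transpose (mat c) = mat (cnj c)"
  by (simp add: vec_eq_iff mat_def)

lemma inner_mult_complex: "(a * x) \<bullet> y = x \<bullet> (cnj a * y)" for a :: complex
  by (simp add: inner_complex_def algebra_simps)

text \<open>The inner product on complex vectors is the real part of the Hermitian one. It suffices here, since a vector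
  orthogonal to itself already vanishes, and it gives access to the theory of Euclidean spaces.\<close>

lemma conj_transpose_dot: "(B *v x) \<bullet> y = x \<bullet> (conj_transpose B *v y)"
  for B :: "complex ^ 'n::finite ^ 'm::finite"
proof -
  have "(B *v x) \<bullet> y = (\<Sum>i\<in>UNIV. \<Sum>j\<in>UNIV. (B $ i $ j * x $ j) \<bullet> (y $ i))"
    by (simp add: inner_vec_def matrix_vector_mult_def inner_sum_left)
  also have "\<dots> = (\<Sum>j\<in>UNIV. \<Sum>i\<in>UNIV. (B $ i $ j * x $ j) \<bullet> (y $ i))"
    by (rule sum.swap)
  finally show ?thesis
    by (simp add: inner_vec_def matrix_vector_mult_def inner_sum_right inner_mult_complex)
qed

lemma column_mult: "column j (C ** Z) = C *v column j Z"
  by (simp add: column_def matrix_matrix_mult_def matrix_vector_mult_def vec_eq_iff)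

lemma matrix_inner_columns: "P \<bullet> Q = (\<Sum>j\<in>UNIV. column j P \<bullet> column j Q)"
  for P Q :: "complex ^ 'k::finite ^ 'n::finite"
  unfolding inner_vec_def column_def by (subst sum.swap) simp

lemma matrix_inner_left: "(A ** X) \<bullet> Y = X \<bullet> (conj_transpose A ** Y)"
  for A :: "complex ^ 'n::finite ^ 'm::finite" and X :: "complex ^ 'k::finite ^ 'n"
  by (simp add: matrix_inner_columns column_mult conj_transpose_dot)

lemma conj_transpose_inner: "conj_transpose X \<bullet> conj_transpose Y = X \<bullet> Y"
  for X :: "complex ^ 'k::finite ^ 'n::finite"
proof -
  have "cnj a \<bullet> cnj b = a \<bullet> b" for a b by (simp add: inner_complex_def)
  then show ?thesis
    unfolding inner_vec_def by (subst sum.swap) simp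
qed

lemma matrix_inner_right: "(X ** A) \<bullet> Y = X \<bullet> (Y ** conj_transpose A)"
  for X :: "complex ^ 'n::finite ^ 'm::finite" and A :: "complex ^ 'k::finite ^ 'n"
  using matrix_inner_left[of "conj_transpose A" "conj_transpose X" "conj_transpose Y"]
    conj_transpose_inner[of "X ** A" Y] conj_transpose_inner[of X "Y ** conj_transpose A"]
  by (simp add: conj_transpose_mult)

lemma matrix_add_rdistrib: "(A + B) ** C = A ** C + B ** C"
  for A :: "'a::comm_semiring_1 ^ 'n ^ 'm"
  by (simp add: vec_eq_iff matrix_matrix_mult_def distrib_right sum.distrib)

lemma matrix_vector_mult_axis: "A *v axis k 1 = column k (A :: 'a::comm_semiring_1 ^ 'n::finite ^ 'm)"
  by (simp add: matrix_vector_mult_def axis_def column_def vec_eq_iff if_distrib[of "\<lambda>x. _ * x"] cong: if_cong)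

lemma hermitian_parts:
  fixes X :: "complex ^ 'n::finite ^ 'n"
  obtains P Q where "P = mat (1/2) ** (X + conj_transpose X)"
    "Q = mat (- \<i>/2) ** (X + mat (- 1) ** conj_transpose X)"
    "X = P + mat \<i> ** Q" "conj_transpose P = P" "conj_transpose Q = Q"
proof -
  define P Q where P: "P = mat (1/2) ** (X + conj_transpose X)"
    and Q: "Q = mat (- \<i>/2) ** (X + mat (- 1) ** conj_transpose X)"
  have "X = P + mat \<i> ** Q" "conj_transpose P = P" "conj_transpose Q = Q"
    by (simp_all add: P Q vec_eq_iff algebra_simps)
  with P Q show thesis by (rule that)
qed

lemma scaleR_eq_vector_smult: "c *\<^sub>R x = complex_of_real c *s x"
  unfolding vec_eq_iff by (simp add: complex_eq_iff)

text \<open>A Hermitian matrix is a symmetric operator of the underlying real space, and a complex subspace is in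
  particular a real one.\<close>

lemma hermitian_eigenvector_in_subspace:
  fixes X :: "complex ^ 'n::finite ^ 'n"
  assumes X: "conj_transpose X = X" and S: "vec.subspace S" "S \<noteq> {0}" and inv: "\<And>x. x \<in> S \<Longrightarrow> X *v x \<in> S"
  obtains x c where "x \<in> S" "x \<noteq> 0" "X *v x = complex_of_real c *s x"
proof -
  have "subspace S"
    using S(1) by (auto simp: subspace_def vec.subspace_def scaleR_eq_vector_smult)
  moreover have "linear ((*v) X)"
    by (simp add: linear_iff matrix_vector_right_distrib) (simp add: vec_eq_iff matrix_vector_mult_def scaleR_sum_right)
  moreover have "(X *v x) \<bullet> y = x \<bullet> (X *v y)" for x y
    using conj_transpose_dot[of X x y] by (simp add: X)
  ultimately obtain x c where "x \<in> S" "norm x = 1" "X *v x = c *\<^sub>R x"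
    using symmetric_eigenvector_in_subspace[of "(*v) X" S] S(2) inv by metis
  moreover from this have "x \<noteq> 0" by auto
  ultimately show thesis using that by (simp add: scaleR_eq_vector_smult)
qed


section \<open>Burnside's theorem and Schur's lemma\<close>

text \<open>Burnside's theorem for algebras closed under adjoints. Let \<open>T\<close> be a nonzero Hermitian element of smallest rank. For
  Hermitian \<open>X\<close> in the algebra, \<open>T X T\<close> has an eigenvalue \<open>c\<close> on the range of \<open>T\<close>. The Hermitian element
  \<open>T (T X T - c) T\<close> has smaller rank than \<open>T\<close>, hence it is zero, and \<open>T X T\<close> is the scalar \<open>c\<close> on the range of \<open>T\<close>.
  The same then holds for every \<open>X\<close>. As the algebra moves \<open>T y\<close> to every vector, the range of \<open>T\<close> is a line. So the
  algebra contains the projection onto a line up to a factor, and with it all products \<open>a b\<^sup>*\<close>.\<close>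

lemma burnside_star_algebra:
  fixes \<A> :: "(complex ^ 't::finite ^ 't) set"
  assumes one: "mat 1 \<in> \<A>" and add: "\<And>X Y. X \<in> \<A> \<Longrightarrow> Y \<in> \<A> \<Longrightarrow> X + Y \<in> \<A>"
    and scale: "\<And>c X. X \<in> \<A> \<Longrightarrow> mat c ** X \<in> \<A>"
    and mult: "\<And>X Y. X \<in> \<A> \<Longrightarrow> Y \<in> \<A> \<Longrightarrow> X ** Y \<in> \<A>"
    and star: "\<And>X. X \<in> \<A> \<Longrightarrow> conj_transpose X \<in> \<A>"
    and irr: "\<And>W. vec.subspace W \<Longrightarrow> (\<And>X w. X \<in> \<A> \<Longrightarrow> w \<in> W \<Longrightarrow> X *v w \<in> W) \<Longrightarrow> W = {0} \<or> W = UNIV"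
  shows "\<A> = UNIV"
proof -
  \<comment> \<open>the orbit of a nonzero vector is an invariant subspace, hence everything\<close>
  have trans: "\<exists>X\<in>\<A>. X *v y = z" if "y \<noteq> 0" for y z
  proof -
    let ?W = "(\<lambda>X. X *v y) ` \<A>"
    have "vec.subspace ?W"
      unfolding vec.subspace_def
    proof (intro conjI ballI allI)
      have "mat 0 ** mat 1 \<in> \<A>" by (rule scale[OF one])
      moreover have "(mat 0 ** mat 1) *v y = 0" by (simp add: matrix_vector_mul_assoc[symmetric])
      ultimately show "0 \<in> ?W" by (metis image_eqI)
    next
      fix a b assume "a \<in> ?W" "b \<in> ?W"
      then show "a + b \<in> ?W" using add by (auto simp: matrix_vector_mult_add_rdistrib[symmetric])
    next
      fix c a assume "a \<in> ?W"
      then obtain X where "X \<in> \<A>" "a = X *v y" by blast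
      then have "mat c ** X \<in> \<A>" "c *s a = (mat c ** X) *v y"
        using scale by (auto simp: matrix_vector_mul_assoc[symmetric])
      then show "c *s a \<in> ?W" by blast
    qed
    moreover have "X *v w \<in> ?W" if "X \<in> \<A>" "w \<in> ?W" for X w
      using that mult by (auto simp: matrix_vector_mul_assoc)
    ultimately have "?W = {0} \<or> ?W = UNIV" by (rule irr)
    moreover have "y \<in> ?W" using one by (metis image_eqI matrix_vector_mul_lid)
    ultimately have "z \<in> ?W" using that by auto
    then show ?thesis by blast
  qed
  \<comment> \<open>smallest rank is expressed as largest kernel\<close>
  define good where "good X \<longleftrightarrow> X \<in> \<A> \<and> X \<noteq> 0 \<and> conj_transpose X = X" for X
  define nul where "nul X = dim {v. X *v v = 0}" for X :: "complex ^ 't ^ 't"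
  have "mat 1 \<noteq> (0 :: complex ^ 't ^ 't)"
    by (auto simp: vec_eq_iff mat_def)
  then have "good (mat 1)" using one by (simp add: good_def)
  moreover have "\<forall>X. good X \<longrightarrow> nul X < Suc (DIM(complex ^ 't))"
    unfolding nul_def less_Suc_eq_le by (intro allI impI dim_subset_UNIV)
  ultimately obtain T where T: "good T" and maxT: "\<And>X. good X \<Longrightarrow> nul X \<le> nul T"
    using ex_has_greatest_nat[of good "mat 1" nul "Suc (DIM(complex ^ 't))"] by (metis less_imp_le)
  have TA: "T \<in> \<A>" and T0: "T \<noteq> 0" and Th: "conj_transpose T = T" using T by (auto simp: good_def)
  let ?R = "range ((*v) T)"
  have injR: "y = 0" if y: "y \<in> ?R" "T *v y = 0" for y
  proof -
    obtain z where z: "y = T *v z" using y(1) by blast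
    have "y \<bullet> y = z \<bullet> (T *v y)" using conj_transpose_dot[of T z y] by (simp add: z Th)
    then show ?thesis using y(2) by simp
  qed
  have R_sub: "vec.subspace ?R" by (rule vec.subspace_image) simp
  have R_ne: "?R \<noteq> {0}"
  proof
    assume "?R = {0}"
    then have "\<forall>x. T *v x = 0 *v x" by auto
    then show False using T0 by (simp add: matrix_eq)
  qed
  have scalar_herm: "\<exists>c. \<forall>y\<in>?R. (T ** X) *v (T *v y) = c *s y"
    if X: "X \<in> \<A>" "conj_transpose X = X" for X
  proof -
    let ?B = "T ** X ** T"
    have "conj_transpose ?B = ?B" by (simp add: conj_transpose_mult Th X(2) matrix_mul_assoc)
    moreover have "?B *v x \<in> ?R" for x by (simp add: matrix_vector_mul_assoc[symmetric])
    ultimately obtain x c where x: "x \<in> ?R" "x \<noteq> 0" "?B *v x = complex_of_real c *s x"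
      using hermitian_eigenvector_in_subspace[OF _ R_sub R_ne] by metis
    let ?D = "T ** ?B ** T + mat (- complex_of_real c) ** (T ** T)"
    have Dv: "?D *v v = T *v (?B *v (T *v v) - complex_of_real c *s (T *v v))" for v
      by (simp add: matrix_vector_mult_add_rdistrib matrix_vector_mul_assoc[symmetric]
          matrix_vector_mult_diff_distrib vector_scalar_commute[symmetric] matrix_vector_mult_minus_right)
    have "?D = 0"
    proof (rule ccontr)
      assume D0: "?D \<noteq> 0"
      have "?D \<in> \<A>" by (intro add mult scale TA X(1))
      moreover have "conj_transpose ?D = ?D"
        by (simp add: conj_transpose_mult conj_transpose_add Th X(2) matrix_mul_assoc mat_commute)
      ultimately have "good ?D" using D0 by (simp add: good_def)
      then have le: "nul ?D \<le> nul T" by (rule maxT)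
      obtain z where z: "x = T *v z" using x(1) by blast
      have "?D *v z = 0" using x(3) by (simp add: Dv z[symmetric])
      moreover have "?D *v v = 0" if "T *v v = 0" for v by (simp add: Dv that)
      ultimately have sub: "{v. T *v v = 0} \<subset> {v. ?D *v v = 0}"
        using z x(2) by blast
      have "subspace {v. Y *v v = 0}" for Y :: "complex ^ 't ^ 't"
        by (auto simp: subspace_def matrix_vector_right_distrib scaleR_eq_vector_smult vector_scalar_commute)
      then have "nul T < nul ?D"
        unfolding nul_def using sub by (intro dim_psubset) (simp add: span_eq_iff[THEN iffD2])
      then show False using le by simp
    qed
    have "?B *v y = complex_of_real c *s y" if y: "y \<in> ?R" for y
    proof -
      obtain v where v: "y = T *v v" using y by blast
      have "?B *v y - complex_of_real c *s y \<in> ?R"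
        using R_sub y by (intro vec.subspace_diff vec.subspace_scale) (auto simp: matrix_vector_mul_assoc[symmetric])
      moreover have "T *v (?B *v y - complex_of_real c *s y) = 0"
        using Dv[of v] \<open>?D = 0\<close> by (simp add: v)
      ultimately have "?B *v y - complex_of_real c *s y = 0" by (rule injR)
      then show ?thesis by simp
    qed
    then show ?thesis by (auto simp: matrix_vector_mul_assoc matrix_mul_assoc)
  qed
  have scalar: "\<exists>c. \<forall>y\<in>?R. (T ** X) *v (T *v y) = c *s y" if X: "X \<in> \<A>" for X
  proof -
    obtain P Q where P: "P = mat (1/2) ** (X + conj_transpose X)"
      and Q: "Q = mat (- \<i>/2) ** (X + mat (- 1) ** conj_transpose X)"
      and H: "X = P + mat \<i> ** Q" "conj_transpose P = P" "conj_transpose Q = Q"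
      by (rule hermitian_parts)
    have "P \<in> \<A>" "Q \<in> \<A>" unfolding P Q by (intro add scale star X)+
    then obtain a b where ab: "\<forall>y\<in>?R. (T ** P) *v (T *v y) = a *s y" "\<forall>y\<in>?R. (T ** Q) *v (T *v y) = b *s y"
      using scalar_herm H(2,3) by metis
    have "(T ** X) *v (T *v y) = (a + \<i> * b) *s y" if "y \<in> ?R" for y
    proof -
      have "T ** X = T ** P + mat \<i> ** (T ** Q)" by (simp add: H(1) matrix_add_ldistrib mat_mult_assoc)
      then have "(T ** X) *v (T *v y) = (T ** P) *v (T *v y) + \<i> *s ((T ** Q) *v (T *v y))"
        by (simp add: matrix_vector_mult_add_rdistrib matrix_vector_mul_assoc[of "mat \<i>", symmetric])
      then show ?thesis using ab that by (simp add: vec.scale_left_distrib)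
    qed
    then show ?thesis by blast
  qed
  obtain y where y: "y \<in> ?R" "y \<noteq> 0" using R_ne R_sub vec.subspace_0 by blast
  then have Ty: "T *v y \<noteq> 0" using injR by blast
  have rank_one: "\<exists>c. T *v v = c *s y" for v
  proof -
    obtain X where "X \<in> \<A>" "X *v (T *v y) = v" using trans[OF Ty] by blast
    then show ?thesis using scalar[of X] y(1) by (metis matrix_vector_mul_assoc)
  qed
  obtain \<mu> where mu: "\<mu> \<noteq> 0" "\<And>i j. T $ i $ j = \<mu> * y $ i * cnj (y $ j)"
  proof -
    have "\<exists>c. \<forall>j. T *v axis j 1 = c j *s y" by (intro choice allI rank_one)
    then obtain c where "\<And>j. column j T = c j *s y"
      unfolding matrix_vector_mult_axis by blast
    then have c: "T $ i $ j = c j * y $ i" for i j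
      by (metis column_def vec_lambda_beta vector_smult_component)
    obtain k where k: "y $ k \<noteq> 0" using y(2) by (auto simp: vec_eq_iff)
    have cj: "c j = cnj (c k) * cnj (y $ j) / y $ k" for j
    proof -
      have "cnj (c k * y $ j) = c j * y $ k"
        using arg_cong[OF Th, of "\<lambda>X. X $ k $ j"] by (simp only: conj_transpose_nth c)
      then show ?thesis using k by (simp add: nonzero_eq_divide_eq)
    qed
    have eq: "T $ i $ j = cnj (c k) / y $ k * y $ i * cnj (y $ j)" for i j
      unfolding c[of i j] cj[of j] by simp
    moreover have "cnj (c k) / y $ k \<noteq> 0" using eq T0 by (auto simp: vec_eq_iff)
    ultimately show thesis using that by blast
  qed
  \<comment> \<open>\<open>X T Y\<^sup>*\<close> with \<open>X y = a\<close> and \<open>Y y = b\<close> is \<open>\<mu> a b\<^sup>*\<close>\<close>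
  have elem: "(\<chi> i j. a $ i * cnj (b $ j)) \<in> \<A>" for a b :: "complex ^ 't"
  proof -
    obtain X Y where XY: "X \<in> \<A>" "Y \<in> \<A>" "X *v y = a" "Y *v y = b" using trans[OF y(2)] by metis
    have "mat (1 / \<mu>) ** (X ** T ** conj_transpose Y) \<in> \<A>" by (intro scale mult star XY TA)
    moreover have "mat (1 / \<mu>) ** (X ** T ** conj_transpose Y) = (\<chi> i j. a $ i * cnj (b $ j))"
    proof -
      have XT: "(X ** T) $ i $ j = \<mu> * a $ i * cnj (y $ j)" for i j
        unfolding XY(3)[symmetric]
        by (simp add: matrix_matrix_mult_def matrix_vector_mult_def mu(2) sum_distrib_left sum_distrib_right mult_ac)
      have "(X ** T ** conj_transpose Y) $ i $ j = \<mu> * a $ i * cnj (b $ j)" for i j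
        unfolding XY(4)[symmetric] matrix_matrix_mult_def[of "X ** T"]
        by (simp add: XT matrix_vector_mult_def sum_distrib_left mult_ac)
      then show ?thesis using mu(1) by (simp add: vec_eq_iff)
    qed
    ultimately show ?thesis by simp
  qed
  have sum: "(\<Sum>i\<in>I. F i) \<in> \<A>" if "finite I" "\<And>i. i \<in> I \<Longrightarrow> F i \<in> \<A>" for F and I :: "'t set"
    using that
  proof (induction I)
    case empty
    have "mat 0 ** mat 1 \<in> \<A>" by (rule scale[OF one])
    moreover have "mat 0 ** mat 1 = (0 :: complex ^ 't ^ 't)" by (simp add: vec_eq_iff)
    ultimately show ?case by simp
  qed (simp add: add)
  have "X \<in> \<A>" for X
  proof -
    have "(\<Sum>k\<in>UNIV. (\<chi> i j. column k X $ i * cnj (axis k 1 $ j))) \<in> \<A>"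
      by (intro sum elem) simp
    moreover have "(\<Sum>k\<in>UNIV. (\<chi> i j. column k X $ i * cnj (axis k 1 $ j))) = X"
      by (simp add: vec_eq_iff column_def axis_def if_distrib[of cnj] if_distrib[of "\<lambda>x. _ * x"] cong: if_cong)
    ultimately show ?thesis by simp
  qed
  then show ?thesis by blast
qed

lemma commute_add: "X ** Z = Z ** X \<Longrightarrow> Y ** Z = Z ** Y \<Longrightarrow> (X + Y) ** Z = Z ** (X + Y)"
  for X :: "'a::comm_semiring_1 ^ 'n::finite ^ 'n"
  unfolding matrix_add_ldistrib matrix_add_rdistrib by (rule arg_cong2[where f = "(+)"])

lemma commute_scale: "X ** Z = Z ** X \<Longrightarrow> (mat c ** X) ** Z = Z ** (mat c ** X)"
  for X :: "'a::comm_semiring_1 ^ 'n::finite ^ 'n"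
  unfolding mat_mult_assoc matrix_mul_assoc[of "mat c", symmetric] by (rule arg_cong)

text \<open>An eigenspace of a Hermitian operator that commutes with \<open>\<pi>\<close> is invariant, hence everything. For unitary \<open>\<pi>\<close> the
  adjoint of \<open>X\<close> commutes with \<open>\<pi>\<close> as well, and so do the two Hermitian parts of \<open>X\<close>.\<close>

lemma schur_scalar:
  assumes \<pi>: "unitary_rep K \<pi>" "irreducible_rep K \<pi>"
    and X: "\<And>k. k \<in> K \<Longrightarrow> X ** \<pi> k = \<pi> k ** X"
  obtains c where "X = mat c"
proof -
  have unit: "conj_transpose (\<pi> k) ** \<pi> k = mat 1" "\<pi> k ** conj_transpose (\<pi> k) = mat 1" if "k \<in> K" for k
    using \<pi>(1) that by (auto simp: unitary_rep_def)
  have herm: "\<exists>c. Y = mat c" if Y: "conj_transpose Y = Y" "\<And>k. k \<in> K \<Longrightarrow> Y ** \<pi> k = \<pi> k ** Y" for Y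
  proof -
    have "(UNIV :: (complex ^ 'b) set) \<noteq> {0}"
      by (metis UNIV_I axis_eq_0_iff singletonD zero_neq_one)
    then obtain x c where x: "x \<noteq> 0" "Y *v x = complex_of_real c *s x"
      using hermitian_eigenvector_in_subspace[OF Y(1) vec.subspace_UNIV] by auto
    let ?W = "{v. Y *v v = complex_of_real c *s v}"
    have "vec.subspace ?W"
      by (auto simp: vec.subspace_def matrix_vector_right_distrib vec.scale_right_distrib
          vector_scalar_commute mult.commute)
    moreover have "\<pi> k *v w \<in> ?W" if "k \<in> K" "w \<in> ?W" for k w
      using that Y(2)[OF that(1)] by (simp add: matrix_vector_mul_assoc vector_scalar_commute)
        (simp add: matrix_vector_mul_assoc[symmetric] vector_scalar_commute)
    ultimately have "?W = {0} \<or> ?W = UNIV" using \<pi>(2) by (auto simp: irreducible_rep_def)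
    then have "?W = UNIV" using x by auto
    then have "Y = mat (complex_of_real c)" by (auto simp: matrix_eq)
    then show ?thesis by blast
  qed
  have X': "conj_transpose X ** \<pi> k = \<pi> k ** conj_transpose X" if "k \<in> K" for k
  proof -
    have "\<pi> k ** (conj_transpose (X ** \<pi> k)) ** \<pi> k = \<pi> k ** (conj_transpose (\<pi> k ** X)) ** \<pi> k"
      by (simp add: X[OF that])
    then have "(\<pi> k ** conj_transpose (\<pi> k)) ** (conj_transpose X ** \<pi> k) = (\<pi> k ** conj_transpose X) ** (conj_transpose (\<pi> k) ** \<pi> k)"
      by (simp add: conj_transpose_mult matrix_mul_assoc)
    then show ?thesis by (simp add: unit[OF that])
  qed
  obtain P Q where P: "P = mat (1/2) ** (X + conj_transpose X)"
    and Q: "Q = mat (- \<i>/2) ** (X + mat (- 1) ** conj_transpose X)"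
    and H: "X = P + mat \<i> ** Q" "conj_transpose P = P" "conj_transpose Q = Q"
    by (rule hermitian_parts)
  have "P ** \<pi> k = \<pi> k ** P" "Q ** \<pi> k = \<pi> k ** Q" if "k \<in> K" for k
    unfolding P Q by (intro commute_scale commute_add X X' that)+
  then obtain a b where "P = mat a" "Q = mat b" using herm H(2,3) by metis
  then have "X = mat (a + \<i> * b)" using H(1) by (simp add: mat_mult_mat) (simp add: mat_def vec_eq_iff)
  then show thesis using that by blast
qed

section \<open>Compact matrix groups and averaging\<close>

lemma continuous_on_matrix_mult [continuous_intros]:
  fixes f :: "'a::topological_space \<Rightarrow> 'b::real_normed_algebra_1 ^ 'n ^ 'm" and g :: "'a \<Rightarrow> 'b ^ 'k ^ 'n"
  assumes "continuous_on S f" "continuous_on S g"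
  shows "continuous_on S (\<lambda>x. f x ** g x)"
  unfolding matrix_matrix_mult_def
  by (intro continuous_on_vec_lambda continuous_intros assms continuous_on_component)

lemma continuous_on_conj_transpose [continuous_intros]:
  "continuous_on S f \<Longrightarrow> continuous_on S (\<lambda>x. conj_transpose (f x))"
  unfolding conj_transpose_def
  by (intro continuous_on_vec_lambda continuous_intros continuous_on_component)

lemma continuous_on_transpose_real [continuous_intros]:
  "continuous_on S f \<Longrightarrow> continuous_on S (\<lambda>x. transpose (f x :: real ^ 'm ^ 'n))"
  unfolding transpose_def
  by (intro continuous_on_vec_lambda continuous_intros continuous_on_component)

lemma continuous_on_det_real [continuous_intros]:
  "continuous_on S f \<Longrightarrow> continuous_on S (\<lambda>x. det (f x :: real ^ 'm::finite ^ 'm))"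
  unfolding det_def by (intro continuous_intros continuous_on_component)

lemma continuous_on_embO [continuous_intros]:
  fixes f :: "_ \<Rightarrow> real ^ 'n::finite ^ 'n"
  assumes f: "continuous_on S f"
  shows "continuous_on S (\<lambda>x. embO (f x))"
  unfolding embO_def
proof (intro continuous_on_vec_lambda)
  fix i j :: "'n option"
  show "continuous_on S (\<lambda>x. case (i, j) of (Some r, Some s) \<Rightarrow> f x $ r $ s | (None, None) \<Rightarrow> det (f x) | _ \<Rightarrow> 0)"
    using f by (cases i; cases j) (auto intro!: continuous_intros continuous_on_component)
qed

lemma compact_O_grp: "compact (O_grp :: (real ^ 'm::finite ^ 'm) set)"
proof -
  have "closed {Q :: real ^ 'm ^ 'm. transpose Q ** Q = mat 1}"
    by (intro closed_Collect_eq continuous_intros)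
  moreover have "bounded {Q :: real ^ 'm ^ 'm. transpose Q ** Q = mat 1}"
  proof (rule boundedI)
    fix Q :: "real ^ 'm ^ 'm" assume "Q \<in> {Q. transpose Q ** Q = mat 1}"
    then have "norm (Q $ i) = 1" for i
      using orthogonal_matrix_orthonormal_rows[of Q] by (simp add: orthogonal_matrix row_def)
    then have "(\<Sum>i\<in>UNIV. norm (Q $ i)) = real CARD('m)" by simp
    then show "norm Q \<le> real CARD('m)"
      by (metis norm_le_l1_cart norm_vec_def L2_set_le_sum norm_ge_zero)
  qed
  ultimately show ?thesis by (simp add: O_grp_def orthogonal_matrix compact_eq_bounded_closed)
qed

lemma compact_SO_grp: "compact (SO_grp :: (real ^ 'm::finite ^ 'm) set)"
proof -
  have "SO_grp = O_grp \<inter> {Q :: real ^ 'm ^ 'm. det Q = 1}"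
    by (auto simp: SO_grp_def O_grp_def rotation_matrix_def)
  moreover have "closed {Q :: real ^ 'm ^ 'm. det Q = 1}"
    by (intro closed_Collect_eq continuous_intros)
  ultimately show ?thesis using compact_Int_closed[OF compact_O_grp] by metis
qed

definition compact_group :: "(real ^ 'm ^ 'm) set \<Rightarrow> bool" where
  "compact_group K \<longleftrightarrow> compact K \<and> K \<subseteq> O_grp \<and> mat 1 \<in> K \<and>
     (\<forall>g\<in>K. transpose g \<in> K \<and> (\<forall>h\<in>K. g ** h \<in> K))"

lemma compact_group_O: "compact_group (O_grp :: (real ^ 'm::finite ^ 'm) set)"
  by (auto simp: compact_group_def compact_O_grp)
    (auto simp: O_grp_def orthogonal_matrix_id orthogonal_matrix_mul)

lemma compact_group_SO: "compact_group (SO_grp :: (real ^ 'm::finite ^ 'm) set)"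
  unfolding compact_group_def
  by (intro conjI compact_SO_grp) (auto simp: O_grp_def SO_grp_def rotation_matrix_def
      orthogonal_matrix_id orthogonal_matrix_mul det_mul det_transpose)

lemma transpose_mult_O: "g \<in> O_grp \<Longrightarrow> transpose g ** g = mat 1" "g \<in> O_grp \<Longrightarrow> g ** transpose g = mat 1"
  by (auto simp: O_grp_def orthogonal_matrix_def)

lemma unitary_rep_subset: "unitary_rep K \<rho> \<Longrightarrow> H \<subseteq> K \<Longrightarrow> unitary_rep H \<rho>"
  by (auto simp: unitary_rep_def representation_def intro: continuous_on_subset)

lemma unitary_repD:
  assumes "unitary_rep K \<rho>"
  shows "continuous_on K \<rho>" "\<rho> (mat 1) = mat 1"
    "\<And>g h. g \<in> K \<Longrightarrow> h \<in> K \<Longrightarrow> \<rho> (g ** h) = \<rho> g ** \<rho> h"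
    "\<And>g. g \<in> K \<Longrightarrow> conj_transpose (\<rho> g) ** \<rho> g = mat 1"
    "\<And>g. g \<in> K \<Longrightarrow> \<rho> g ** conj_transpose (\<rho> g) = mat 1"
  using assms by (auto simp: unitary_rep_def representation_def)

lemma unitary_rep_transpose:
  assumes K: "compact_group K" and \<rho>: "unitary_rep K \<rho>" and g: "g \<in> K"
  shows "\<rho> (transpose g) = conj_transpose (\<rho> g)"
proof -
  have gt: "transpose g \<in> K" "transpose g ** g = mat 1" using K g by (auto simp: compact_group_def transpose_mult_O)
  have "\<rho> (transpose g) = \<rho> (transpose g) ** (\<rho> g ** conj_transpose (\<rho> g))"
    using unitary_repD(5)[OF \<rho> g] by simp
  also have "\<dots> = \<rho> (transpose g ** g) ** conj_transpose (\<rho> g)"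
    by (simp add: unitary_repD(3)[OF \<rho> gt(1) g] matrix_mul_assoc)
  finally show ?thesis by (simp add: gt unitary_repD(2)[OF \<rho>])
qed

lemma unitary_rep_embO:
  assumes \<tau>: "unitary_rep SO_grp \<tau>"
  shows "unitary_rep O_grp (\<lambda>k. \<tau> (embO k))"
proof -
  have "continuous_on O_grp (\<lambda>k. \<tau> (embO k))"
    by (rule continuous_on_compose2[OF unitary_repD(1)[OF \<tau>]])
      (auto intro!: continuous_intros embO_in_SO)
  then show ?thesis
    using \<tau> embO_in_SO by (auto simp: unitary_rep_def representation_def embO_one embO_mult)
qed

lemma haar_probD:
  assumes "haar_prob K M"
  shows "finite_measure M" "measure M (space M) = 1" "space M = K"
    "sets M = sets (restrict_space borel K)" "\<And>h. h \<in> K \<Longrightarrow> distr M M (\<lambda>k. h ** k) = M"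
  using assms by (auto simp: haar_prob_def measure_def intro: finite_measureI)

lemma haar_integrable:
  fixes f :: "_ \<Rightarrow> 'b::euclidean_space"
  assumes M: "haar_prob K M" and K: "compact K" and f: "continuous_on K f"
  shows "integrable M f"
proof -
  interpret finite_measure M by (rule haar_probD(1)[OF M])
  have "compact (f ` K)" using K f by (rule compact_continuous_image[rotated])
  then obtain B where "\<And>x. x \<in> K \<Longrightarrow> norm (f x) \<le> B"
    by (metis bounded_iff compact_imp_bounded image_eqI)
  moreover have "f \<in> borel_measurable M"
    using borel_measurable_continuous_on_restrict[OF f] haar_probD(4)[OF M]
    by (simp cong: measurable_cong_sets)
  ultimately show ?thesis
    using haar_probD(3)[OF M] by (intro integrable_const_bound[of _ B]) (auto intro!: AE_I2)
qed

lemma haar_left_invariant: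
  fixes f :: "_ \<Rightarrow> 'b::euclidean_space"
  assumes M: "haar_prob K M" and K: "compact_group K" and f: "continuous_on K f" and h: "h \<in> K"
  shows "(LINT k|M. f (h ** k)) = (LINT k|M. f k)"
proof -
  have "(\<lambda>k. h ** k) \<in> measurable (restrict_space borel K) (restrict_space borel K)"
    using K h by (intro measurable_restrict_space2 measurable_restrict_space1 borel_measurable_continuous_onI)
      (auto simp: compact_group_def space_restrict_space intro!: continuous_intros)
  then have "(\<lambda>k. h ** k) \<in> measurable M M"
    using haar_probD(4)[OF M] by (simp cong: measurable_cong_sets)
  moreover have "f \<in> borel_measurable M"
    using borel_measurable_continuous_on_restrict[OF f] haar_probD(4)[OF M]
    by (simp cong: measurable_cong_sets)
  ultimately have "integral\<^sup>L (distr M M (\<lambda>k. h ** k)) f = (LINT k|M. f (h ** k))"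
    by (rule integral_distr)
  then show ?thesis by (simp add: haar_probD(5)[OF M h])
qed

lemma haar_const:
  fixes c :: "'b::euclidean_space"
  assumes M: "haar_prob K M" and f: "\<And>k. k \<in> K \<Longrightarrow> f k = c"
  shows "(LINT k|M. f k) = c"
proof -
  have "(LINT k|M. f k) = (LINT k|M. c)"
    using f haar_probD(3)[OF M] by (intro Bochner_Integration.integral_cong) auto
  then show ?thesis by (simp add: haar_probD(2)[OF M])
qed

lemma linear_matrix_mult_left: "linear (\<lambda>X. (A :: complex ^ 'n::finite ^ 'm) ** X)"
  by (simp add: linear_iff matrix_add_ldistrib) (simp add: vec_eq_iff matrix_matrix_mult_def scaleR_sum_right)

lemma linear_matrix_mult_right: "linear (\<lambda>X. X ** (A :: complex ^ 'n ^ 'm::finite))"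
  by (simp add: linear_iff matrix_add_rdistrib) (simp add: vec_eq_iff matrix_matrix_mult_def scaleR_sum_right)

lemma integral_linear:
  fixes L :: "'a::euclidean_space \<Rightarrow> 'b::euclidean_space"
  assumes "integrable M f" "linear L"
  shows "(LINT k|M. L (f k)) = L (LINT k|M. f k)"
  using integral_bounded_linear[of L M f] assms by (simp add: linear_conv_bounded_linear)

text \<open>The component of the integral orthogonal to \<open>R\<close> is the integral of the components orthogonal to \<open>R\<close>.\<close>

lemma integral_in_subspace:
  fixes f :: "_ \<Rightarrow> 'b::euclidean_space"
  assumes f: "integrable M f" and R: "subspace R" "\<And>k. k \<in> space M \<Longrightarrow> f k \<in> R"
  shows "(LINT k|M. f k) \<in> R"
proof -
  obtain p q where p: "p \<in> span R" and q: "\<And>w. w \<in> span R \<Longrightarrow> orthogonal q w"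
    and eq: "(LINT k|M. f k) = p + q"
    using orthogonal_subspace_decomp_exists by metis
  have "q \<bullet> (LINT k|M. f k) = (LINT k|M. q \<bullet> f k)"
    using f by (simp add: integral_inner_right)
  also have "\<dots> = (LINT k|M. 0)"
    using q R(2) by (intro Bochner_Integration.integral_cong) (auto simp: orthogonal_def span_base)
  finally have "q \<bullet> q = 0"
    using q[OF p] by (simp add: eq inner_add_right orthogonal_def)
  then show ?thesis using p R(1) eq by (simp add: span_eq_iff[THEN iffD2])
qed

text \<open>The orthogonal projection of the space of linear maps onto the maps that intertwine \<open>\<delta>\<close> with \<open>\<rho>\<close>, for unitary
  representations of a compact group with Haar measure \<open>M\<close>.\<close>

definition haar_average ::
    "(real ^ 'm ^ 'm) measure \<Rightarrow> (real ^ 'm ^ 'm \<Rightarrow> complex ^ 't ^ 't) \<Rightarrow>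
     (real ^ 'm ^ 'm \<Rightarrow> complex ^ 'd ^ 'd) \<Rightarrow> complex ^ 'd ^ 't \<Rightarrow> complex ^ 'd ^ 't" where
  "haar_average M \<rho> \<delta> V = (LINT k|M. \<rho> k ** V ** conj_transpose (\<delta> k))"

lemma haar_average_integrable:
  fixes V :: "complex ^ 'd::finite ^ 't::finite"
  assumes "haar_prob K M" "compact K" "unitary_rep K \<rho>" "unitary_rep K \<delta>"
  shows "integrable M (\<lambda>k. \<rho> k ** V ** conj_transpose (\<delta> k))"
  by (rule haar_integrable[OF assms(1,2)])
    (intro continuous_intros unitary_repD(1)[OF assms(3)] unitary_repD(1)[OF assms(4)])

lemma haar_average_intertwines:
  fixes V :: "complex ^ 'd::finite ^ 't::finite"
  assumes M: "haar_prob K M" and K: "compact_group K" and \<rho>: "unitary_rep K \<rho>" and \<delta>: "unitary_rep K \<delta>"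
    and h: "h \<in> K"
  shows "haar_average M \<rho> \<delta> V ** \<delta> h = \<rho> h ** haar_average M \<rho> \<delta> V"
proof -
  let ?F = "\<lambda>k. \<rho> k ** V ** conj_transpose (\<delta> k)"
  have cont: "continuous_on K ?F" by (intro continuous_intros unitary_repD(1)[OF \<rho>] unitary_repD(1)[OF \<delta>])
  have comp: "compact K" using K by (simp add: compact_group_def)
  have "\<rho> h ** haar_average M \<rho> \<delta> V = (LINT k|M. \<rho> h ** ?F k)"
    unfolding haar_average_def
    by (rule integral_linear[symmetric, OF haar_average_integrable[OF M comp \<rho> \<delta>] linear_matrix_mult_left])
  also have "\<dots> = (LINT k|M. ?F (h ** k) ** \<delta> h)"
  proof (rule Bochner_Integration.integral_cong[OF refl])
    fix k assume "k \<in> space M"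
    then have k: "k \<in> K" by (simp add: haar_probD(3)[OF M])
    have "?F (h ** k) ** \<delta> h = \<rho> h ** \<rho> k ** V ** conj_transpose (\<delta> k) ** (conj_transpose (\<delta> h) ** \<delta> h)"
      by (simp add: unitary_repD(3)[OF \<rho> h k] unitary_repD(3)[OF \<delta> h k] conj_transpose_mult matrix_mul_assoc)
    then show "\<rho> h ** ?F k = ?F (h ** k) ** \<delta> h"
      by (simp add: unitary_repD(4)[OF \<delta> h] matrix_mul_assoc)
  qed
  also have "\<dots> = (LINT k|M. ?F k ** \<delta> h)"
    by (rule haar_left_invariant[OF M K _ h]) (intro continuous_intros cont)
  also have "\<dots> = haar_average M \<rho> \<delta> V ** \<delta> h"
    unfolding haar_average_def
    by (rule integral_linear[OF haar_average_integrable[OF M comp \<rho> \<delta>] linear_matrix_mult_right])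
  finally show ?thesis by simp
qed

lemma haar_average_intertwiner:
  assumes M: "haar_prob K M" and \<rho>: "unitary_rep K \<rho>" and X: "\<And>k. k \<in> K \<Longrightarrow> X ** \<rho> k = \<rho> k ** X"
  shows "haar_average M \<rho> \<rho> X = X"
  unfolding haar_average_def
proof (rule haar_const[OF M])
  fix k assume k: "k \<in> K"
  show "\<rho> k ** X ** conj_transpose (\<rho> k) = X"
    by (simp add: X[OF k, symmetric] matrix_mul_assoc[symmetric] unitary_repD(5)[OF \<rho> k])
qed

lemma intertwiner_adjoint:
  assumes K: "compact_group K" and \<rho>: "unitary_rep K \<rho>" and \<delta>: "unitary_rep K \<delta>"
    and T: "\<And>k. k \<in> K \<Longrightarrow> T ** \<delta> k = \<rho> k ** T" and k: "k \<in> K"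
  shows "conj_transpose T ** \<rho> k = \<delta> k ** conj_transpose T"
proof -
  have kt: "transpose k \<in> K" using K k by (simp add: compact_group_def)
  have "conj_transpose (T ** \<delta> (transpose k)) = conj_transpose (\<rho> (transpose k) ** T)"
    by (simp add: T[OF kt])
  then show ?thesis
    by (simp add: unitary_rep_transpose[OF K \<rho> k] unitary_rep_transpose[OF K \<delta> k] conj_transpose_mult)
qed

section \<open>Multiplicity one\<close>

definition commutant :: "(real ^ ('n::finite option) ^ ('n option) \<Rightarrow> complex ^ 't ^ 't) \<Rightarrow> (complex ^ 't ^ 't) set" where
  "commutant \<tau> = {Y. \<forall>k\<in>(SO_grp :: (real ^ 'n ^ 'n) set). Y ** \<tau> (embO k) = \<tau> (embO k) ** Y}"

lemma det_O_grp: "s \<in> O_grp \<Longrightarrow> det s = 1 \<or> det s = - 1"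
  using det_orthogonal_matrix by (auto simp: O_grp_def)

text \<open>SO(n) is normal in O(n).\<close>

lemma commutant_conjugate:
  fixes \<tau> :: "real ^ ('n::finite option) ^ ('n option) \<Rightarrow> complex ^ 't::finite ^ 't"
  assumes \<tau>: "unitary_rep SO_grp \<tau>" and s: "s \<in> O_grp" and Y: "Y \<in> commutant \<tau>"
  shows "\<tau> (embO s) ** Y ** conj_transpose (\<tau> (embO s)) \<in> commutant \<tau>"
  unfolding commutant_def
proof (intro CollectI ballI)
  fix k :: "real ^ 'n ^ 'n" assume k: "k \<in> SO_grp"
  note \<rho> = unitary_rep_embO[OF \<tau>]
  let ?s' = "transpose s"
  let ?h = "?s' ** k ** s"
  have s': "?s' \<in> O_grp" using s compact_group_O by (auto simp: compact_group_def)
  have kO: "k \<in> O_grp" using k SO_subset_O by blast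
  have h: "?h \<in> SO_grp"
    using k s s' det_O_grp[OF s] by (auto simp: SO_grp_def O_grp_def rotation_matrix_def orthogonal_matrix_mul det_mul det_transpose)
  then have hO: "?h \<in> O_grp" using SO_subset_O by blast
  have "conj_transpose (\<tau> (embO s)) ** \<tau> (embO k) = \<tau> (embO (?s' ** k))"
    using unitary_repD(3)[OF \<rho> s' kO] unitary_rep_transpose[OF compact_group_O \<rho> s] by simp
  also have "?s' ** k = ?h ** ?s'"
    using transpose_mult_O(2)[OF s] by (simp add: matrix_mul_assoc[symmetric])
  also have "\<tau> (embO (?h ** ?s')) = \<tau> (embO ?h) ** conj_transpose (\<tau> (embO s))"
    using unitary_repD(3)[OF \<rho> hO s'] unitary_rep_transpose[OF compact_group_O \<rho> s] by simp
  finally have 1: "conj_transpose (\<tau> (embO s)) ** \<tau> (embO k) = \<tau> (embO ?h) ** conj_transpose (\<tau> (embO s))" .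
  have "s ** ?h = k ** s"
    using transpose_mult_O(2)[OF s] by (simp add: matrix_mul_assoc)
  then have 2: "\<tau> (embO s) ** \<tau> (embO ?h) = \<tau> (embO k) ** \<tau> (embO s)"
    using unitary_repD(3)[OF \<rho> s hO] unitary_repD(3)[OF \<rho> kO s] by simp
  have 3: "Y ** \<tau> (embO ?h) = \<tau> (embO ?h) ** Y" using Y h by (auto simp: commutant_def)
  have "\<tau> (embO s) ** Y ** conj_transpose (\<tau> (embO s)) ** \<tau> (embO k)
      = \<tau> (embO s) ** (Y ** \<tau> (embO ?h)) ** conj_transpose (\<tau> (embO s))"
    using 1 by (simp add: matrix_mul_assoc[symmetric])
  also have "\<dots> = (\<tau> (embO s) ** \<tau> (embO ?h)) ** Y ** conj_transpose (\<tau> (embO s))"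
    by (simp only: 3 matrix_mul_assoc)
  finally show "\<tau> (embO s) ** Y ** conj_transpose (\<tau> (embO s)) ** \<tau> (embO k) =
      \<tau> (embO k) ** (\<tau> (embO s) ** Y ** conj_transpose (\<tau> (embO s)))"
    by (simp only: 2 matrix_mul_assoc)
qed

lemma commutant_conj_transpose:
  fixes \<tau> :: "real ^ ('n::finite option) ^ ('n option) \<Rightarrow> complex ^ 't::finite ^ 't"
  assumes \<tau>: "unitary_rep SO_grp \<tau>" and Y: "Y \<in> commutant \<tau>"
  shows "conj_transpose Y \<in> commutant \<tau>"
proof -
  note \<rho> = unitary_rep_subset[OF unitary_rep_embO[OF \<tau>] SO_subset_O]
  show ?thesis
    using intertwiner_adjoint[OF compact_group_SO \<rho> \<rho>, of Y] Y by (simp add: commutant_def)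
qed

lemma linear_maps_span:
  assumes "linear f" "x \<in> span S" "\<And>s. s \<in> S \<Longrightarrow> f s \<in> span T"
  shows "f x \<in> span T"
proof -
  have "f x \<in> span (f ` S)" using assms(1,2) by (simp add: linear_span_image)
  moreover have "span (f ` S) \<subseteq> span T" using assms(3) by (intro span_minimal) auto
  ultimately show ?thesis by blast
qed

lemma span_rep_mult:
  assumes K: "compact_group K" and \<tau>: "unitary_rep K \<tau>"
    and X: "X \<in> span (\<tau> ` K)" and Y: "Y \<in> span (\<tau> ` K)"
  shows "X ** Y \<in> span (\<tau> ` K)"
proof (rule linear_maps_span[OF linear_matrix_mult_right X])
  fix Z assume "Z \<in> \<tau> ` K"
  then obtain g where g: "g \<in> K" "Z = \<tau> g" by blast
  show "Z ** Y \<in> span (\<tau> ` K)"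
  proof (rule linear_maps_span[OF linear_matrix_mult_left Y])
    fix W assume "W \<in> \<tau> ` K"
    then obtain h where h: "h \<in> K" "W = \<tau> h" by blast
    have "Z ** W = \<tau> (g ** h)" "g ** h \<in> K"
      using g h K unitary_repD(3)[OF \<tau>] by (simp_all add: compact_group_def)
    then show "Z ** W \<in> span (\<tau> ` K)" by (simp add: span_base)
  qed
qed

lemma linear_conj_transpose: "linear conj_transpose"
  by (simp add: linear_iff conj_transpose_add conj_transpose_scaleR)

lemma span_rep_conj_transpose:
  assumes K: "compact_group K" and \<tau>: "unitary_rep K \<tau>" and X: "X \<in> span (\<tau> ` K)"
  shows "conj_transpose X \<in> span (\<tau> ` K)"
proof (rule linear_maps_span[OF linear_conj_transpose X])
  fix Z assume "Z \<in> \<tau> ` K"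
  then obtain h where h: "h \<in> K" "Z = \<tau> h" by blast
  have "conj_transpose Z = \<tau> (transpose h)" "transpose h \<in> K"
    using h K unitary_rep_transpose[OF K \<tau> h(1)] by (simp_all add: compact_group_def)
  then show "conj_transpose Z \<in> span (\<tau> ` K)" by (simp add: span_base)
qed

text \<open>The real span \<open>R\<close> of the image of \<open>\<tau>\<close> is closed under products and adjoints, so \<open>R + \<i> R\<close> is a complex algebra
  closed under adjoints, to which Burnside's theorem applies. Real coefficients are kept apart because the adjoint is
  only conjugate linear, which matters for identities that equate an adjoint with a linear expression.\<close>

lemma irreducible_rep_span:
  fixes X :: "complex ^ 't::finite ^ 't"
  assumes K: "compact_group K" and \<tau>: "unitary_rep K \<tau>" "irreducible_rep K \<tau>"
  obtains P Q where "P \<in> span (\<tau> ` K)" "Q \<in> span (\<tau> ` K)" "X = P + mat \<i> ** Q"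
proof -
  let ?R = "span (\<tau> ` K)"
  note mult = span_rep_mult[OF K \<tau>(1)] and star = span_rep_conj_transpose[OF K \<tau>(1)]
  let ?A = "{P + mat \<i> ** Q |P Q. P \<in> ?R \<and> Q \<in> ?R}"
  have base: "P \<in> ?A" if "P \<in> ?R" for P
  proof -
    have "P = P + mat \<i> ** 0" by (simp add: vec_eq_iff)
    then show ?thesis using that span_zero by blast
  qed
  have "?A = UNIV"
  proof (rule burnside_star_algebra)
    have "mat 1 \<in> ?R" using K unitary_repD(2)[OF \<tau>(1)] by (metis compact_group_def image_eqI span_base)
    then show "mat 1 \<in> ?A" by (rule base)
  next
    fix X Y assume "X \<in> ?A" "Y \<in> ?A"
    then obtain P Q P' Q' where *: "X = P + mat \<i> ** Q" "Y = P' + mat \<i> ** Q'" "P \<in> ?R" "Q \<in> ?R" "P' \<in> ?R" "Q' \<in> ?R"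
      by blast
    have "X + Y = (P + P') + mat \<i> ** (Q + Q')" by (simp add: * matrix_add_ldistrib)
    then show "X + Y \<in> ?A" using * by (blast intro: span_add)
    have "X ** Y = (P ** P' - Q ** Q') + mat \<i> ** (P ** Q' + Q ** P')"
    proof -
      have "(mat \<i> ** Q) ** (mat \<i> ** Q') = - (Q ** Q')"
        unfolding matrix_mul_assoc[of "mat \<i>" Q, symmetric] mat_mult_assoc[of Q] mat_mult_mat_mult
        by (simp add: vec_eq_iff)
      then show ?thesis
        by (simp add: * matrix_add_ldistrib matrix_add_rdistrib mat_mult_assoc[of P]) (simp add: matrix_mul_assoc)
    qed
    then show "X ** Y \<in> ?A" using * mult by (blast intro: span_add span_diff)
  next
    fix c X assume "X \<in> ?A"
    then obtain P Q where *: "X = P + mat \<i> ** Q" "P \<in> ?R" "Q \<in> ?R" by blast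
    have "mat c ** X = (Re c *\<^sub>R P - Im c *\<^sub>R Q) + mat \<i> ** (Im c *\<^sub>R P + Re c *\<^sub>R Q)"
      by (simp add: * vec_eq_iff complex_eq_iff algebra_simps)
    then show "mat c ** X \<in> ?A" using * by (blast intro: span_add span_diff span_scale)
  next
    fix X assume "X \<in> ?A"
    then obtain P Q where *: "X = P + mat \<i> ** Q" "P \<in> ?R" "Q \<in> ?R" by blast
    have "conj_transpose X = conj_transpose P + mat \<i> ** (- conj_transpose Q)"
      by (simp add: * vec_eq_iff)
    then show "conj_transpose X \<in> ?A" using * star by (blast intro: span_neg)
  next
    fix W assume W: "vec.subspace W" "\<And>X w. X \<in> ?A \<Longrightarrow> w \<in> W \<Longrightarrow> X *v w \<in> W"
    have "\<tau> g *v w \<in> W" if "g \<in> K" "w \<in> W" for g w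
      by (rule W(2)[OF base]) (use that in \<open>auto intro: span_base\<close>)
    then show "W = {0} \<or> W = UNIV" using W(1) \<tau>(2) by (auto simp: irreducible_rep_def)
  qed
  then have "X \<in> ?A" by blast
  then show thesis using that by blast
qed

lemma matrix_inner_conjugate:
  fixes U X :: "complex ^ 't::finite ^ 't"
  shows "(U ** X ** conj_transpose U) \<bullet> Y = X \<bullet> (conj_transpose U ** Y ** U)"
  using matrix_inner_right[of "U ** X" "conj_transpose U" Y] matrix_inner_left[of U X "Y ** U"]
  by (simp add: matrix_mul_assoc)

text \<open>Both sides lie in the commutant, so it is enough to compare their inner products with an element \<open>Y\<close> of the
  commutant. These are real linear in \<open>Z\<close>, which reduces the claim to \<open>Z = \<tau>(g)\<close>. There the adjoint is
  \<open>\<tau>(k) \<tau>(g) \<tau>(k)\<^sup>*\<close> for some \<open>k\<close> in O(n) with the determinant of \<open>s\<close>, and \<open>k\<close> differs from \<open>s\<close> by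
  an element of SO(n), whose image commutes with the whole commutant.\<close>

lemma commutant_span_conj_transpose:
  fixes \<tau> :: "real ^ ('n::finite option) ^ ('n option) \<Rightarrow> complex ^ 't::finite ^ 't" and s :: "real ^ 'n ^ 'n"
  assumes card: "CARD('n) = 2 * m" and \<tau>: "unitary_rep SO_grp \<tau>"
    and s: "s \<in> O_grp" "det s = (- 1) ^ m"
    and Z: "Z \<in> span (\<tau> ` SO_grp)" "Z \<in> commutant \<tau>"
  shows "conj_transpose Z = \<tau> (embO s) ** Z ** conj_transpose (\<tau> (embO s))"
proof -
  let ?S = "\<tau> (embO s)"
  note \<rho> = unitary_rep_embO[OF \<tau>]
  have s': "transpose s \<in> O_grp" using s compact_group_O by (auto simp: compact_group_def)
  have eq: "conj_transpose Z \<bullet> Y = (?S ** Z ** conj_transpose ?S) \<bullet> Y" if Y: "Y \<in> commutant \<tau>" for Y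
  proof (rule linear_eq_on_span[OF _ _ _ Z(1)])
    show "linear (\<lambda>Z. conj_transpose Z \<bullet> Y)"
      by (simp add: linear_iff conj_transpose_add conj_transpose_scaleR inner_add_left)
    show "linear (\<lambda>Z. (?S ** Z ** conj_transpose ?S) \<bullet> Y)"
      by (simp add: linear_iff matrix_add_ldistrib matrix_add_rdistrib inner_add_left
          linear_scale[OF linear_matrix_mult_left] linear_scale[OF linear_matrix_mult_right])
  next
    fix X assume "X \<in> \<tau> ` SO_grp"
    then obtain g where g: "g \<in> SO_grp" "X = \<tau> g" by blast
    obtain k :: "real ^ 'n ^ 'n" where k: "k \<in> O_grp" "det k = (- 1) ^ m" "embO k ** g = transpose g ** embO k"
      using rotation_conjugate_to_inverse[OF card g(1)] by blast
    have kS: "embO k \<in> SO_grp" by (rule embO_in_SO[OF k(1)])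
    let ?h = "transpose s ** k"
    have h: "?h \<in> SO_grp"
      using k s by (auto simp: SO_grp_def O_grp_def rotation_matrix_def orthogonal_matrix_mul det_mul det_transpose
          power_mult_distrib[symmetric])
    then have hO: "?h \<in> O_grp" using SO_subset_O by blast
    have "k = s ** ?h" using transpose_mult_O(2)[OF s(1)] by (simp add: matrix_mul_assoc)
    then have k_eq: "\<tau> (embO k) = ?S ** \<tau> (embO ?h)"
      using unitary_repD(3)[OF \<rho> s(1) hO] by simp
    have gt: "transpose g \<in> SO_grp" using g compact_group_SO by (auto simp: compact_group_def)
    have "\<tau> (embO k) ** \<tau> g = conj_transpose (\<tau> g) ** \<tau> (embO k)"
      using unitary_repD(3)[OF \<tau> kS g(1)] unitary_repD(3)[OF \<tau> gt kS] k(3)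
        unitary_rep_transpose[OF compact_group_SO \<tau> g(1)] by simp
    then have "conj_transpose (\<tau> g) = \<tau> (embO k) ** \<tau> g ** conj_transpose (\<tau> (embO k))"
      using unitary_repD(5)[OF \<tau> kS] by (simp add: matrix_mul_assoc[symmetric])
    then have "conj_transpose (\<tau> g) \<bullet> Y = \<tau> g \<bullet> (conj_transpose (\<tau> (embO k)) ** Y ** \<tau> (embO k))"
      by (simp only: matrix_inner_conjugate)
    also have "conj_transpose (\<tau> (embO k)) ** Y ** \<tau> (embO k)
        = conj_transpose (\<tau> (embO ?h)) ** ((conj_transpose ?S ** Y ** ?S) ** \<tau> (embO ?h))"
      by (simp add: k_eq conj_transpose_mult matrix_mul_assoc)
    also have "conj_transpose ?S ** Y ** ?S \<in> commutant \<tau>"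
      using commutant_conjugate[OF \<tau> s' Y] unitary_rep_transpose[OF compact_group_O \<rho> s(1)] by simp
    then have "(conj_transpose ?S ** Y ** ?S) ** \<tau> (embO ?h) = \<tau> (embO ?h) ** (conj_transpose ?S ** Y ** ?S)"
      using h by (simp add: commutant_def)
    also have "conj_transpose (\<tau> (embO ?h)) ** (\<tau> (embO ?h) ** (conj_transpose ?S ** Y ** ?S)) = conj_transpose ?S ** Y ** ?S"
      using unitary_repD(4)[OF \<rho> hO] by (simp add: matrix_mul_assoc)
    also have "\<tau> g \<bullet> (conj_transpose ?S ** Y ** ?S) = (?S ** \<tau> g ** conj_transpose ?S) \<bullet> Y"
      by (simp only: matrix_inner_conjugate)
    finally show "conj_transpose X \<bullet> Y = (?S ** X ** conj_transpose ?S) \<bullet> Y" by (simp add: g(2))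
  qed
  let ?D = "conj_transpose Z - ?S ** Z ** conj_transpose ?S"
  have "conj_transpose Z \<in> commutant \<tau>" "?S ** Z ** conj_transpose ?S \<in> commutant \<tau>"
    by (rule commutant_conj_transpose[OF \<tau> Z(2)], rule commutant_conjugate[OF \<tau> s(1) Z(2)])
  then have "?D \<in> commutant \<tau>"
    by (simp add: commutant_def linear_diff[OF linear_matrix_mult_left] linear_diff[OF linear_matrix_mult_right])
  from eq[OF this] have "?D \<bullet> ?D = 0" by (simp add: inner_diff_left)
  then show ?thesis by simp
qed

text \<open>On those real combinations of the \<open>\<tau>(g)\<close> that lie in the commutant, the adjoint, which reverses products, agrees with conjugation by \<open>S\<close>,
  which preserves them. Averaging over SO(n) is the identity on the commutant and maps the real span into itself, so each element of
  the commutant is \<open>P + \<i> Q\<close> with \<open>P\<close> and \<open>Q\<close> in the commutant and in the real span.\<close>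

lemma commutant_commutative:
  fixes \<tau> :: "real ^ ('n::finite option) ^ ('n option) \<Rightarrow> complex ^ 't::finite ^ 't"
    and M :: "(real ^ 'n ^ 'n) measure"
  assumes even: "even CARD('n)" and M: "haar_prob SO_grp M"
    and \<tau>: "unitary_rep SO_grp \<tau>" "irreducible_rep SO_grp \<tau>"
    and X: "X \<in> commutant \<tau>" and Y: "Y \<in> commutant \<tau>"
  shows "X ** Y = Y ** X"
proof -
  let ?R = "span (\<tau> ` SO_grp)"
  let ?C = "commutant \<tau>"
  obtain m where card: "CARD('n) = 2 * m" using even by blast
  obtain s :: "real ^ 'n ^ 'n" where s: "s \<in> O_grp" "det s = (- 1) ^ m"
  proof (cases "even m")
    case True
    then show thesis using that[of "mat 1"] by (simp add: O_grp_def orthogonal_matrix_id)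
  next
    case False
    then show thesis using that[of "refl_mat undefined"] by (simp add: O_grp_def orthogonal_refl_mat det_refl_mat)
  qed
  let ?S = "\<tau> (embO s)"
  have SS: "conj_transpose ?S ** ?S = mat 1"
    using unitary_repD(4)[OF unitary_rep_embO[OF \<tau>(1)] s(1)] by simp
  note adj = commutant_span_conj_transpose[OF card \<tau>(1) s]
  note R_mult = span_rep_mult[OF compact_group_SO \<tau>(1)]
  have C_mult: "Z ** W \<in> ?C" if "Z \<in> ?C" "W \<in> ?C" for Z W
    using that by (auto simp: commutant_def matrix_mul_assoc) (metis matrix_mul_assoc)
  have real: "Z ** W = W ** Z" if Z: "Z \<in> ?R" "Z \<in> ?C" and W: "W \<in> ?R" "W \<in> ?C" for Z W
  proof -
    have "?S ** (Z ** W) ** conj_transpose ?S = conj_transpose (Z ** W)"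
      using adj[OF R_mult[OF Z(1) W(1)] C_mult[OF Z(2) W(2)]] by simp
    also have "\<dots> = ?S ** W ** (conj_transpose ?S ** ?S) ** Z ** conj_transpose ?S"
      by (simp add: conj_transpose_mult adj[OF Z] adj[OF W] matrix_mul_assoc)
    finally have "?S ** (Z ** W) ** conj_transpose ?S = ?S ** (W ** Z) ** conj_transpose ?S"
      by (simp add: SS matrix_mul_assoc)
    then have "conj_transpose ?S ** (?S ** (Z ** W) ** conj_transpose ?S) ** ?S
        = conj_transpose ?S ** (?S ** (W ** Z) ** conj_transpose ?S) ** ?S" by simp
    then have "(conj_transpose ?S ** ?S) ** (Z ** W) ** (conj_transpose ?S ** ?S)
        = (conj_transpose ?S ** ?S) ** (W ** Z) ** (conj_transpose ?S ** ?S)"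
      by (simp only: matrix_mul_assoc)
    then show ?thesis by (simp add: SS)
  qed
  note \<rho> = unitary_rep_subset[OF unitary_rep_embO[OF \<tau>(1)] SO_subset_O]
  let ?\<rho> = "\<lambda>k :: real ^ 'n ^ 'n. \<tau> (embO k)"
  define E where "E Z = haar_average M ?\<rho> ?\<rho> Z" for Z
  have E_C: "E Z \<in> ?C" for Z
    using haar_average_intertwines[OF M compact_group_SO \<rho> \<rho>, of _ Z] by (simp add: commutant_def E_def)
  have int: "integrable M (\<lambda>k. ?\<rho> k ** Z ** conj_transpose (?\<rho> k))" for Z
    by (rule haar_average_integrable[OF M compact_SO_grp \<rho> \<rho>])
  have E_R: "E Z \<in> ?R" if "Z \<in> ?R" for Z
    unfolding E_def haar_average_def
  proof (rule integral_in_subspace[OF int subspace_span])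
    fix k assume "k \<in> space M"
    then have "embO k \<in> SO_grp" using haar_probD(3)[OF M] embO_in_SO SO_subset_O by blast
    then have "?\<rho> k \<in> ?R" by (simp add: span_base)
    then show "?\<rho> k ** Z ** conj_transpose (?\<rho> k) \<in> ?R"
      using that R_mult span_rep_conj_transpose[OF compact_group_SO \<tau>(1)] by blast
  qed
  have E_lin: "E (P + mat \<i> ** Q) = E P + mat \<i> ** E Q" for P Q
  proof -
    have "E (P + mat \<i> ** Q) = (LINT k|M. ?\<rho> k ** P ** conj_transpose (?\<rho> k)
        + mat \<i> ** (?\<rho> k ** Q ** conj_transpose (?\<rho> k)))"
      unfolding E_def haar_average_def
      by (rule Bochner_Integration.integral_cong[OF refl])
        (simp add: matrix_add_ldistrib matrix_add_rdistrib mat_mult_assoc, simp add: matrix_mul_assoc)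
    also have "\<dots> = E P + (LINT k|M. mat \<i> ** (?\<rho> k ** Q ** conj_transpose (?\<rho> k)))"
      unfolding E_def haar_average_def
      by (rule Bochner_Integration.integral_add[OF int integrable_bounded_linear[OF _ int]])
        (simp add: linear_conv_bounded_linear[symmetric] linear_matrix_mult_left)
    finally show ?thesis
      by (simp add: E_def haar_average_def integral_linear[OF int linear_matrix_mult_left])
  qed
  have E_id: "E Z = Z" if "Z \<in> ?C" for Z
    unfolding E_def by (rule haar_average_intertwiner[OF M \<rho>]) (use that in \<open>auto simp: commutant_def\<close>)
  have decomp: "\<exists>P Q. P \<in> ?R \<and> P \<in> ?C \<and> Q \<in> ?R \<and> Q \<in> ?C \<and> Z = P + mat \<i> ** Q" if Z: "Z \<in> ?C" for Z
  proof -
    obtain P Q where "P \<in> ?R" "Q \<in> ?R" "Z = P + mat \<i> ** Q"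
      using irreducible_rep_span[OF compact_group_SO \<tau>] by blast
    then show ?thesis using E_lin E_id[OF Z] E_R E_C by metis
  qed
  obtain P Q where P: "P \<in> ?R" "P \<in> ?C" and Q: "Q \<in> ?R" "Q \<in> ?C" and X: "X = P + mat \<i> ** Q"
    using decomp[OF X] by blast
  obtain P' Q' where P': "P' \<in> ?R" "P' \<in> ?C" and Q': "Q' \<in> ?R" "Q' \<in> ?C" and Y: "Y = P' + mat \<i> ** Q'"
    using decomp[OF Y] by blast
  have "Y ** P = P ** Y" "Y ** Q = Q ** Y"
    unfolding Y by (intro commute_add commute_scale real P Q P' Q')+
  then have "X ** Y = Y ** X"
    unfolding X by (intro commute_add commute_scale) simp_all
  then show ?thesis .
qed

section \<open>Isotypic projections and spherical functions\<close>

lemma mat_mult_cancel: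
  fixes X Y :: "'a::field ^ 'n::finite ^ 'm::finite"
  assumes "c \<noteq> 0" "mat c ** X = mat c ** Y"
  shows "X = Y"
proof -
  have "c * X $ i $ j = c * Y $ i $ j" for i j
    using assms(2) by (simp add: mat_mult_nth[symmetric] del: mat_mult_nth)
  then show ?thesis using assms(1) by (simp add: vec_eq_iff)
qed

lemma matrix_inv_eqI:
  fixes A B :: "'a::field ^ 'n::finite ^ 'n"
  assumes "B ** A = mat 1" "A ** B = mat 1"
  shows "matrix_inv A = B"
proof -
  have "A ** matrix_inv A = mat 1 \<and> matrix_inv A ** A = mat 1"
    unfolding matrix_inv_def by (rule someI_ex) (use assms in blast)
  then have "matrix_inv A = (B ** A) ** matrix_inv A" "B = B ** (A ** matrix_inv A)"
    using assms by simp_all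
  then show ?thesis by (simp only: matrix_mul_assoc)
qed

lemma refl_mat_involution: "refl_mat l ** refl_mat l = (mat 1 :: real ^ 'n::finite ^ 'n)"
proof -
  have "transpose (refl_mat l) = (refl_mat l :: real ^ 'n::finite ^ 'n)"
    by (auto simp: refl_mat_def transpose_def vec_eq_iff)
  then show ?thesis using orthogonal_refl_mat[of l] by (simp add: orthogonal_matrix_def)
qed

text \<open>For another intertwiner \<open>T'\<close>, the operators \<open>T' T\<^sup>*\<close> and \<open>T T\<^sup>*\<close> lie in the commutant and hence commute. By Schur's
  lemma \<open>T\<^sup>* T\<close> and \<open>T\<^sup>* T'\<close> are scalars \<open>c\<close> and \<open>a\<close>. Applying both products to \<open>T\<close> yields \<open>c T' = a T\<close>.\<close>

lemma intertwiner_unique: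
  fixes \<tau> :: "real ^ ('n::finite option) ^ ('n option) \<Rightarrow> complex ^ 't::finite ^ 't"
    and \<pi> :: "real ^ 'n ^ 'n \<Rightarrow> complex ^ 'p::finite ^ 'p" and T :: "complex ^ 'p ^ 't"
  assumes even: "even CARD('n)" and M: "haar_prob (SO_grp :: (real ^ 'n ^ 'n) set) M"
    and \<tau>: "unitary_rep SO_grp \<tau>" "irreducible_rep SO_grp \<tau>"
    and \<pi>: "unitary_rep SO_grp \<pi>" "irreducible_rep SO_grp \<pi>"
    and T: "rep_embedding SO_grp \<pi> (\<lambda>k. \<tau> (embO k)) T"
  obtains c where "c \<noteq> 0" "conj_transpose T ** T = mat c"
    "\<And>T'. (\<And>k. k \<in> SO_grp \<Longrightarrow> T' ** \<pi> k = \<tau> (embO k) ** T') \<Longrightarrow> \<exists>a. T' = mat a ** T"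
proof -
  note \<rho> = unitary_rep_subset[OF unitary_rep_embO[OF \<tau>(1)] SO_subset_O]
  have TT: "T ** \<pi> k = \<tau> (embO k) ** T" if "k \<in> SO_grp" for k
    using T that by (simp add: rep_embedding_def)
  have adj: "conj_transpose U ** \<tau> (embO k) = \<pi> k ** conj_transpose U"
    if "\<And>k. k \<in> SO_grp \<Longrightarrow> U ** \<pi> k = \<tau> (embO k) ** U" "k \<in> SO_grp" for U k
    by (rule intertwiner_adjoint[OF compact_group_SO \<rho> \<pi>(1) that])
  have scalar: "\<exists>a. conj_transpose T ** U = mat a"
    if U: "\<And>k. k \<in> SO_grp \<Longrightarrow> U ** \<pi> k = \<tau> (embO k) ** U" for U
  proof -
    have "(conj_transpose T ** U) ** \<pi> k = \<pi> k ** (conj_transpose T ** U)" if k: "k \<in> SO_grp" for k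
    proof -
      have "(conj_transpose T ** U) ** \<pi> k = (conj_transpose T ** \<tau> (embO k)) ** U"
        by (simp only: matrix_mul_assoc[symmetric] U[OF k])
      then show ?thesis by (simp only: adj[OF TT k] matrix_mul_assoc)
    qed
    then show ?thesis using schur_scalar[OF \<pi>] by metis
  qed
  obtain c where c: "conj_transpose T ** T = mat c" using scalar[OF TT] by blast
  have c0: "c \<noteq> 0"
  proof
    assume "c = 0"
    have "(T *v x) \<bullet> (T *v x) = 0" for x
      using conj_transpose_dot[of T x "T *v x"] by (simp add: matrix_vector_mul_assoc c \<open>c = 0\<close>)
    then have "T *v x = T *v 0" for x by simp
    then have "x = 0" for x :: "complex ^ 'p" using T by (metis injD rep_embedding_def)
    from this[of "axis undefined 1"] show False by (simp add: axis_eq_0_iff)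
  qed
  have "\<exists>a. T' = mat a ** T" if T': "\<And>k. k \<in> SO_grp \<Longrightarrow> T' ** \<pi> k = \<tau> (embO k) ** T'" for T'
  proof -
    obtain a where a: "conj_transpose T ** T' = mat a" using scalar[OF T'] by blast
    have comm: "U ** conj_transpose T \<in> commutant \<tau>"
      if U: "\<And>k. k \<in> SO_grp \<Longrightarrow> U ** \<pi> k = \<tau> (embO k) ** U" for U
      unfolding commutant_def
    proof (intro CollectI ballI)
      fix k :: "real ^ 'n ^ 'n" assume k: "k \<in> SO_grp"
      have "U ** conj_transpose T ** \<tau> (embO k) = (U ** \<pi> k) ** conj_transpose T"
        by (simp only: matrix_mul_assoc[symmetric] adj[OF TT k])
      then show "U ** conj_transpose T ** \<tau> (embO k) = \<tau> (embO k) ** (U ** conj_transpose T)"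
        by (simp only: U[OF k] matrix_mul_assoc)
    qed
    have "(T' ** conj_transpose T) ** (T ** conj_transpose T) = (T ** conj_transpose T) ** (T' ** conj_transpose T)"
      by (rule commutant_commutative[OF even M \<tau> comm[OF T'] comm[OF TT]])
    then have "(T' ** conj_transpose T) ** (T ** conj_transpose T) ** T = (T ** conj_transpose T) ** (T' ** conj_transpose T) ** T"
      by simp
    then have "T' ** (conj_transpose T ** T) ** (conj_transpose T ** T) = T ** (conj_transpose T ** T') ** (conj_transpose T ** T)"
      by (simp only: matrix_mul_assoc)
    then have eq: "T' ** mat c ** mat c = T ** mat a ** mat c" by (simp only: a c)
    have "T' = mat (a / c) ** T"
      using eq c0 by (simp add: vec_eq_iff field_simps)
    then show ?thesis by blast
  qed
  then show thesis using that[OF c0 c] by blast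
qed

lemma embedding_left_inverse:
  fixes T :: "complex ^ 'p::finite ^ 't::finite"
  assumes "conj_transpose T ** T = mat c" "c \<noteq> 0"
  shows "(mat (1 / c) ** conj_transpose T) ** (T ** X) = X"
proof -
  have "(mat (1 / c) ** conj_transpose T) ** (T ** X) = mat (1 / c) ** ((conj_transpose T ** T) ** X)"
    by (simp only: matrix_mul_assoc)
  then show ?thesis using assms by (simp add: vec_eq_iff)
qed

lemma embedding_cancel:
  fixes T :: "complex ^ 'p::finite ^ 't::finite"
  assumes "conj_transpose T ** T = mat c" "c \<noteq> 0" "T ** X = T ** Y"
  shows "X = Y"
  using embedding_left_inverse[OF assms(1,2)] assms(3) by metis

text \<open>A multiple of \<open>T\<close> is an isometry, so \<open>\<delta>\<close> is the restriction of \<open>\<rho>\<close> to an invariant subspace. Continuity on all of O(n) of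
  the representation glued from its values on two cosets of SO(n) is obtained in this way.\<close>

lemma unitary_rep_of_embedding:
  assumes \<rho>: "unitary_rep K \<rho>" and K: "compact_group K"
    and T: "conj_transpose T ** T = mat c" "c \<noteq> 0" and int: "\<And>k. k \<in> K \<Longrightarrow> T ** \<delta> k = \<rho> k ** T"
  shows "unitary_rep K \<delta>"
proof -
  let ?L = "mat (1 / c) ** conj_transpose T"
  note left = embedding_left_inverse[OF T] and cancel = embedding_cancel[OF T]
  have \<delta>: "\<delta> k = ?L ** (\<rho> k ** T)" if "k \<in> K" for k
    using left int[OF that] by metis
  have cont: "continuous_on K (\<lambda>k. ?L ** (\<rho> k ** T))"
    by (intro continuous_intros unitary_repD(1)[OF \<rho>])
  have "continuous_on K \<delta>"
    using cont by (rule continuous_on_cong[OF refl, THEN iffD1, rotated]) (simp add: \<delta>)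
  moreover have "\<delta> (mat 1) = mat 1"
    using K by (intro cancel) (simp add: int unitary_repD(2)[OF \<rho>] compact_group_def)
  moreover have "\<delta> (g ** h) = \<delta> g ** \<delta> h" if g: "g \<in> K" and h: "h \<in> K" for g h
  proof (rule cancel)
    have gh: "g ** h \<in> K" using K g h by (simp add: compact_group_def)
    have "T ** (\<delta> g ** \<delta> h) = \<rho> g ** (T ** \<delta> h)"
      by (simp only: matrix_mul_assoc int[OF g])
    also have "\<dots> = \<rho> (g ** h) ** T"
      by (simp only: int[OF h] unitary_repD(3)[OF \<rho> g h] matrix_mul_assoc)
    finally show "T ** \<delta> (g ** h) = T ** (\<delta> g ** \<delta> h)" by (simp add: int[OF gh])
  qed
  moreover have unit: "conj_transpose (\<delta> g) ** \<delta> g = mat 1" if g: "g \<in> K" for g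
  proof -
    have "mat c ** (conj_transpose (\<delta> g) ** \<delta> g) = conj_transpose (\<delta> g) ** (conj_transpose T ** T) ** \<delta> g"
      by (simp only: T(1) mat_commute matrix_mul_assoc)
    also have "\<dots> = conj_transpose (T ** \<delta> g) ** (T ** \<delta> g)"
      by (simp only: conj_transpose_mult matrix_mul_assoc)
    also have "\<dots> = conj_transpose T ** (conj_transpose (\<rho> g) ** \<rho> g) ** T"
      by (simp only: int[OF g] conj_transpose_mult matrix_mul_assoc)
    also have "\<dots> = mat c ** mat 1" by (simp add: unitary_repD(4)[OF \<rho> g] T(1))
    finally show ?thesis by (rule mat_mult_cancel[OF T(2)])
  qed
  moreover have "\<delta> g ** conj_transpose (\<delta> g) = mat 1" if g: "g \<in> K" for g
    using unit[OF g] by (simp add: matrix_left_right_inverse)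
  ultimately show ?thesis by (simp add: unitary_rep_def representation_def)
qed

text \<open>The diagonal entry of \<open>\<delta>(k)\<^sup>*\<close> at \<open>i\<close>, times \<open>\<tau>(k) v\<close>, is the \<open>i\<close>-th column of \<open>\<tau>(k) V \<delta>(k)\<^sup>*\<close> for the matrix \<open>V\<close>
  whose only nonzero column, the \<open>i\<close>-th, is \<open>v\<close>. Summed over \<open>i\<close> and integrated, this expresses the projection of \<open>v\<close> through averages of
  such \<open>V\<close>. Each average is an intertwiner, hence a multiple of \<open>T\<close>, and taking the trace against \<open>T\<^sup>*\<close> determines the
  factor.\<close>

lemma isotypic_proj_eq:
  fixes \<tau> :: "real ^ ('n::finite option) ^ ('n option) \<Rightarrow> complex ^ 't::finite ^ 't"
    and \<delta> :: "real ^ 'n ^ 'n \<Rightarrow> complex ^ 'p::finite ^ 'p" and T :: "complex ^ 'p ^ 't"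
  assumes M: "haar_prob K M" and K: "compact_group K"
    and \<rho>: "unitary_rep K (\<lambda>k. \<tau> (embO k))" and \<delta>: "unitary_rep K \<delta>"
    and T: "conj_transpose T ** T = mat c" "c \<noteq> 0" and int: "\<And>k. k \<in> K \<Longrightarrow> T ** \<delta> k = \<tau> (embO k) ** T"
    and unique: "\<And>T'. (\<And>k. k \<in> K \<Longrightarrow> T' ** \<delta> k = \<tau> (embO k) ** T') \<Longrightarrow> \<exists>a. T' = mat a ** T"
  shows "isotypic_proj M \<tau> \<delta> = mat (1 / c) ** (T ** conj_transpose T)"
proof -
  let ?\<rho> = "\<lambda>k. \<tau> (embO k)"
  have comp: "compact K" using K by (simp add: compact_group_def)
  let ?d = "of_nat CARD('p) :: complex"
  have d0: "?d \<noteq> 0" by simp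
  define Av where "Av V = haar_average M ?\<rho> \<delta> V" for V
  have intAv: "integrable M (\<lambda>k. ?\<rho> k ** V ** conj_transpose (\<delta> k))" for V
    by (rule haar_average_integrable[OF M comp \<rho> \<delta>])
  have Av: "Av V = mat (trace (conj_transpose T ** V) / (?d * c)) ** T" for V
  proof -
    obtain a where a: "Av V = mat a ** T"
      using unique haar_average_intertwines[OF M K \<rho> \<delta>] unfolding Av_def by blast
    have lin: "linear (\<lambda>X. trace (conj_transpose T ** X))"
      by (simp add: linear_iff matrix_add_ldistrib trace_add linear_scale[OF linear_matrix_mult_left])
        (simp add: trace_def scaleR_sum_right)
    have "trace (conj_transpose T ** Av V) = (LINT k|M. trace (conj_transpose T ** (?\<rho> k ** V ** conj_transpose (\<delta> k))))"
      unfolding Av_def haar_average_def by (rule integral_linear[OF intAv lin, symmetric])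
    also have "\<dots> = trace (conj_transpose T ** V)"
    proof (rule haar_const[OF M])
      fix k assume k: "k \<in> K"
      have "conj_transpose T ** (?\<rho> k ** V ** conj_transpose (\<delta> k)) = (conj_transpose T ** ?\<rho> k) ** (V ** conj_transpose (\<delta> k))"
        by (simp only: matrix_mul_assoc)
      also have "\<dots> = \<delta> k ** (conj_transpose T ** V ** conj_transpose (\<delta> k))"
        using intertwiner_adjoint[OF K \<rho> \<delta> int k] by (simp add: matrix_mul_assoc)
      finally have "trace (conj_transpose T ** (?\<rho> k ** V ** conj_transpose (\<delta> k)))
          = trace (conj_transpose T ** V ** (conj_transpose (\<delta> k) ** \<delta> k))"
        by (metis trace_mul_sym matrix_mul_assoc)
      then show "trace (conj_transpose T ** (?\<rho> k ** V ** conj_transpose (\<delta> k))) = trace (conj_transpose T ** V)"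
        by (simp add: unitary_repD(4)[OF \<delta> k])
    qed
    also have "conj_transpose T ** Av V = mat (a * c)"
      by (simp only: a mat_mult_assoc T(1) mat_mult_mat)
    also have "trace (mat (a * c) :: complex ^ 'p ^ 'p) = ?d * (a * c)"
      by (simp add: trace_def mat_def)
    finally have "a = trace (conj_transpose T ** V) / (?d * c)"
      using T(2) d0 by (simp add: field_simps)
    then show ?thesis by (simp add: a)
  qed
  define col :: "complex ^ 't \<Rightarrow> 'p \<Rightarrow> complex ^ 'p ^ 't"
    where "col v i = (\<chi> r j. if j = i then v $ r else 0)" for v :: "complex ^ 't" and i :: 'p
  have col_vec: "col v i *v x = x $ i *s v" for v i x
    by (simp add: col_def matrix_vector_mult_def vec_eq_iff if_distrib[of "\<lambda>x. x * _"] cong: if_cong)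
  have trace_col: "trace (conj_transpose T ** col v i) = (conj_transpose T *v v) $ i" for v i
  proof -
    have "(conj_transpose T ** col v i) $ j $ j = (if j = i then (conj_transpose T *v v) $ i else 0)" for j
      by (simp add: matrix_matrix_mult_def matrix_vector_mult_def col_def)
    then show ?thesis by (simp add: trace_def)
  qed
  have chi_inv: "chi \<delta> (matrix_inv k) = ?d * (\<Sum>i\<in>UNIV. conj_transpose (\<delta> k) $ i $ i)" if k: "k \<in> K" for k
  proof -
    have kO: "k \<in> O_grp" using k K by (auto simp: compact_group_def)
    have "matrix_inv k = transpose k"
      using transpose_mult_O[OF kO] by (intro matrix_inv_eqI)
    then show ?thesis using unitary_rep_transpose[OF K \<delta> k] by (simp add: chi_def trace_def)
  qed
  have "isotypic_proj M \<tau> \<delta> *v v = (mat (1 / c) ** (T ** conj_transpose T)) *v v" for v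
  proof -
    have lin: "linear (\<lambda>X :: complex ^ 't ^ 't. X *v v)" for v
      by (simp add: linear_iff matrix_vector_mult_add_rdistrib) (simp add: vec_eq_iff matrix_vector_mult_def scaleR_sum_right)
    have lin': "linear (\<lambda>X :: complex ^ 'p ^ 't. ?d *s (X *v axis i 1))" for i
      by (simp add: linear_iff matrix_vector_mult_add_rdistrib vec.scale_right_distrib)
        (simp add: vec_eq_iff matrix_vector_mult_def scaleR_sum_right sum_distrib_left)
    have contF: "continuous_on K (\<lambda>k. mat (?d * (\<Sum>i\<in>UNIV. conj_transpose (\<delta> k) $ i $ i)) ** ?\<rho> k)"
    proof -
      have "continuous_on K (\<lambda>k. (\<chi> r s. ?d * (\<Sum>i\<in>UNIV. conj_transpose (\<delta> k) $ i $ i) * ?\<rho> k $ r $ s))"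
        by (intro continuous_on_vec_lambda continuous_intros continuous_on_component
            unitary_repD(1)[OF \<rho>] unitary_repD(1)[OF \<delta>])
      moreover have "(\<chi> r s. ?d * (\<Sum>i\<in>UNIV. conj_transpose (\<delta> k) $ i $ i) * ?\<rho> k $ r $ s)
          = mat (?d * (\<Sum>i\<in>UNIV. conj_transpose (\<delta> k) $ i $ i)) ** ?\<rho> k" for k
        by (simp add: vec_eq_iff)
      ultimately show ?thesis by simp
    qed
    have "isotypic_proj M \<tau> \<delta> = (LINT k|M. mat (?d * (\<Sum>i\<in>UNIV. conj_transpose (\<delta> k) $ i $ i)) ** ?\<rho> k)"
      unfolding isotypic_proj_def
      by (rule Bochner_Integration.integral_cong[OF refl]) (simp add: haar_probD(3)[OF M] chi_inv)
    then have "isotypic_proj M \<tau> \<delta> *v v = (LINT k|M. (mat (?d * (\<Sum>i\<in>UNIV. conj_transpose (\<delta> k) $ i $ i)) ** ?\<rho> k) *v v)"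
      by (simp only: integral_linear[OF haar_integrable[OF M comp contF] lin])
    also have "\<dots> = (LINT k|M. (\<Sum>i\<in>UNIV. ?d *s ((?\<rho> k ** col v i ** conj_transpose (\<delta> k)) *v axis i 1)))"
    proof (rule Bochner_Integration.integral_cong[OF refl])
      fix k
      have "(?\<rho> k ** col v i ** conj_transpose (\<delta> k)) *v axis i 1 = conj_transpose (\<delta> k) $ i $ i *s (?\<rho> k *v v)" for i
        by (simp only: matrix_vector_mul_assoc[symmetric] col_vec)
          (simp add: matrix_vector_mult_axis column_def vector_scalar_commute)
      then show "(mat (?d * (\<Sum>i\<in>UNIV. conj_transpose (\<delta> k) $ i $ i)) ** ?\<rho> k) *v v
          = (\<Sum>i\<in>UNIV. ?d *s ((?\<rho> k ** col v i ** conj_transpose (\<delta> k)) *v axis i 1))"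
        by (simp add: matrix_vector_mul_assoc[symmetric] vec.scale_sum_left sum_distrib_left)
    qed
    also have "\<dots> = (\<Sum>i\<in>UNIV. (LINT k|M. ?d *s ((?\<rho> k ** col v i ** conj_transpose (\<delta> k)) *v axis i 1)))"
      using lin' by (intro Bochner_Integration.integral_sum integrable_bounded_linear[OF _ intAv])
        (simp add: linear_conv_bounded_linear)
    also have "\<dots> = (\<Sum>i\<in>UNIV. ?d *s (Av (col v i) *v axis i 1))"
      unfolding Av_def haar_average_def by (simp only: integral_linear[OF intAv lin'])
    also have "\<dots> = (\<Sum>i\<in>UNIV. (1 / c) *s (T *v ((conj_transpose T *v v) $ i *s axis i 1)))"
      using d0 by (simp add: Av trace_col matrix_vector_mul_assoc[symmetric] vector_scalar_commute)
    also have "\<dots> = (1 / c) *s (T *v (\<Sum>i\<in>UNIV. (conj_transpose T *v v) $ i *s axis i 1))"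
      by (simp add: vec.scale_sum_right vec.sum)
    also have "(\<Sum>i\<in>UNIV. (conj_transpose T *v v) $ i *s axis i 1) = conj_transpose T *v v"
      by (rule basis_expansion)
    finally show ?thesis by (simp add: matrix_vector_mul_assoc[symmetric])
  qed
  then show ?thesis by (simp add: matrix_eq)
qed

theorem theorem3p2:
  fixes l :: "'n :: finite"
    and \<tau> :: "real ^ ('n option) ^ ('n option) \<Rightarrow> complex ^ 't ^ 't"
    and \<pi> :: "real ^ 'n ^ 'n \<Rightarrow> complex ^ 'p ^ 'p"
    and T :: "complex ^ 'p ^ 't"
    and A :: "complex ^ 'p ^ 'p"
    and \<gamma> :: "real ^ 'n ^ 'n \<Rightarrow> complex ^ 'p ^ 'p"
    and M\<^sub>S M\<^sub>O :: "(real ^ 'n ^ 'n) measure"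
  assumes "even CARD('n)"
    and "haar_prob SO_grp M\<^sub>S"
    and "haar_prob O_grp M\<^sub>O"
    and "unitary_rep SO_grp \<tau>" and "irreducible_rep SO_grp \<tau>"
    and "unitary_rep SO_grp \<pi>" and "irreducible_rep SO_grp \<pi>"
    and "rep_embedding SO_grp \<pi> (\<lambda>k. \<tau> (embO k)) T"
    and "equivalent_reps SO_grp \<pi> (twist l \<pi>)"
    and A_def: "A = pull_back T (spherical M\<^sub>S \<tau> \<pi> (embO (refl_mat l)))"
    and \<gamma>_def: "\<gamma> = rep_eps l \<pi> A"
  shows "range ((*v) T) = isotypic M\<^sub>S \<tau> \<pi> \<and>
    spherical M\<^sub>S \<tau> \<pi> (embO (refl_mat l)) ` isotypic M\<^sub>S \<tau> \<pi> \<subseteq> isotypic M\<^sub>S \<tau> \<pi> \<and>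
    invertible A \<and> A ** A = mat 1 \<and>
    (\<forall>k\<in>SO_grp. twist l \<pi> k = A ** \<pi> k ** matrix_inv A) \<and>
    isotypic M\<^sub>O \<tau> \<gamma> = isotypic M\<^sub>S \<tau> \<pi> \<and>
    (\<forall>g\<in>SO_grp. spherical M\<^sub>S \<tau> \<pi> g = spherical M\<^sub>O \<tau> \<gamma> g)"
proof -
  let ?a = "refl_mat l" and ?\<rho> = "\<lambda>k :: real ^ 'n ^ 'n. \<tau> (embO k)"
  note \<rho>O = unitary_rep_embO[OF assms(4)]
  note \<rho>S = unitary_rep_subset[OF \<rho>O SO_subset_O]
  have a: "?a \<in> O_grp" by (simp add: O_grp_def orthogonal_refl_mat)
  have aa: "?a ** ?a = mat 1" by (rule refl_mat_involution)
  have inj: "inj ((*v) T)" and TS: "\<And>k. k \<in> SO_grp \<Longrightarrow> T ** \<pi> k = ?\<rho> k ** T"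
    using assms(8) by (simp_all add: rep_embedding_def)
  obtain c where c: "c \<noteq> 0" "conj_transpose T ** T = mat c"
    and unique: "\<And>T'. (\<And>k. k \<in> SO_grp \<Longrightarrow> T' ** \<pi> k = ?\<rho> k ** T') \<Longrightarrow> \<exists>b. T' = mat b ** T"
    using intertwiner_unique[OF assms(1,2,4,5,6,7,8)] by blast
  note cancel = embedding_cancel[OF c(2,1)]
  have PS: "isotypic_proj M\<^sub>S \<tau> \<pi> = mat (1 / c) ** (T ** conj_transpose T)"
    by (rule isotypic_proj_eq[OF assms(2) compact_group_SO \<rho>S assms(6) c(2,1) TS unique])

  have conj_a: "?a ** k ** ?a \<in> SO_grp" if "k \<in> SO_grp" for k :: "real ^ 'n ^ 'n"
    using that a by (simp add: SO_grp_def O_grp_def rotation_matrix_def orthogonal_matrix_mul det_mul det_refl_mat)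
  have \<rho>_conj: "?\<rho> (?a ** k ** ?a) = ?\<rho> ?a ** ?\<rho> k ** ?\<rho> ?a" if "k \<in> SO_grp" for k
  proof -
    have "k \<in> O_grp" "?a ** k \<in> O_grp"
      using that SO_subset_O a compact_group_O unfolding compact_group_def by blast+
    then show ?thesis using a by (simp add: unitary_repD(3)[OF \<rho>O])
  qed
  have \<rho>aa: "?\<rho> ?a ** ?\<rho> ?a = mat 1"
    using unitary_repD(3)[OF \<rho>O a a] unitary_repD(2)[OF \<rho>O] by (simp add: aa)

  \<comment> \<open>\<open>\<tau>(a) T B\<close> intertwines \<open>\<pi>\<close> with \<open>\<tau>\<close>, so it is a multiple of \<open>T\<close>\<close>
  obtain A0 where A0: "T ** A0 = ?\<rho> ?a ** T"
  proof -
    obtain B where B: "invertible B" "\<And>k. k \<in> SO_grp \<Longrightarrow> B ** \<pi> k = \<pi> (?a ** k ** ?a) ** B"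
      using assms(9) by (auto simp: equivalent_reps_def twist_def)
    have "(?\<rho> ?a ** T ** B) ** \<pi> k = ?\<rho> k ** (?\<rho> ?a ** T ** B)" if k: "k \<in> SO_grp" for k
    proof -
      have "(?\<rho> ?a ** T ** B) ** \<pi> k = ?\<rho> ?a ** (T ** \<pi> (?a ** k ** ?a)) ** B"
        by (simp only: matrix_mul_assoc[symmetric] B(2)[OF k])
      also have "\<dots> = (?\<rho> ?a ** ?\<rho> ?a) ** ?\<rho> k ** ?\<rho> ?a ** T ** B"
        by (simp only: TS[OF conj_a[OF k]] \<rho>_conj[OF k] matrix_mul_assoc)
      finally show ?thesis by (simp add: \<rho>aa matrix_mul_assoc)
    qed
    then obtain b where b: "?\<rho> ?a ** T ** B = mat b ** T" using unique by blast
    obtain B' where B': "B ** B' = mat 1" using B(1) by (auto simp: invertible_def)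
    have "T ** (mat b ** B') = (mat b ** T) ** B'"
      by (simp only: mat_mult_assoc matrix_mul_assoc[of "mat b"])
    also have "\<dots> = ?\<rho> ?a ** T"
      unfolding b[symmetric] by (simp add: matrix_mul_assoc[symmetric] B')
    finally show thesis by (rule that)
  qed

  have P_T: "isotypic_proj M\<^sub>S \<tau> \<pi> *v (T *v x) = T *v x" for x
  proof -
    have "isotypic_proj M\<^sub>S \<tau> \<pi> *v (T *v x) = (1 / c) *s (T *v ((conj_transpose T ** T) *v x))"
      by (simp add: PS matrix_vector_mul_assoc[symmetric])
    then show ?thesis using c by (simp add: vector_scalar_commute)
  qed
  have range: "range ((*v) T) = isotypic M\<^sub>S \<tau> \<pi>"
  proof
    show "range ((*v) T) \<subseteq> isotypic M\<^sub>S \<tau> \<pi>"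
      unfolding isotypic_def using P_T by (metis image_subsetI rangeI)
    have "isotypic_proj M\<^sub>S \<tau> \<pi> *v v = T *v ((1 / c) *s (conj_transpose T *v v))" for v
      by (simp add: PS matrix_vector_mul_assoc[symmetric] vector_scalar_commute)
    then show "isotypic M\<^sub>S \<tau> \<pi> \<subseteq> range ((*v) T)"
      unfolding isotypic_def by auto
  qed
  have sph: "spherical M\<^sub>S \<tau> \<pi> (embO ?a) (T *v x) = T *v (A0 *v x)" for x
  proof -
    have "T *v x \<in> isotypic M\<^sub>S \<tau> \<pi>" using range by blast
    then have "spherical M\<^sub>S \<tau> \<pi> (embO ?a) (T *v x) = isotypic_proj M\<^sub>S \<tau> \<pi> *v ((?\<rho> ?a ** T) *v x)"
      by (simp add: spherical_def matrix_vector_mul_assoc[symmetric])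
    also have "\<dots> = T *v (A0 *v x)"
      by (simp only: A0[symmetric] matrix_vector_mul_assoc[symmetric] P_T)
    finally show ?thesis .
  qed
  have A: "A = A0"
    unfolding A_def pull_back_def by (simp add: sph inv_f_f[OF inj] matrix_of_matrix_vector_mul)
  then have TA: "T ** A = ?\<rho> ?a ** T" using A0 by simp
  have AA: "A ** A = mat 1"
  proof (rule cancel)
    have "T ** (A ** A) = (T ** A) ** A" by (simp only: matrix_mul_assoc)
    also have "\<dots> = ?\<rho> ?a ** (T ** A)" by (subst TA) (simp only: matrix_mul_assoc)
    also have "\<dots> = (?\<rho> ?a ** ?\<rho> ?a) ** T" by (simp only: TA matrix_mul_assoc)
    finally show "T ** (A ** A) = T ** mat 1" by (simp add: \<rho>aa)
  qed
  have A_inv: "matrix_inv A = A" by (rule matrix_inv_eqI[OF AA AA])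
  have tw: "twist l \<pi> k = A ** \<pi> k ** matrix_inv A" if k: "k \<in> SO_grp" for k
  proof (rule cancel)
    have "T ** twist l \<pi> k = ?\<rho> ?a ** ?\<rho> k ** (?\<rho> ?a ** T)"
      by (simp only: twist_def TS[OF conj_a[OF k]] \<rho>_conj[OF k] matrix_mul_assoc)
    also have "\<dots> = ?\<rho> ?a ** (T ** \<pi> k) ** A"
      by (simp only: TA[symmetric] TS[OF k] matrix_mul_assoc)
    also have "\<dots> = T ** (A ** \<pi> k ** matrix_inv A)"
      by (simp only: A_inv matrix_mul_assoc TA)
    finally show "T ** twist l \<pi> k = T ** (A ** \<pi> k ** matrix_inv A)" .
  qed

  have TO: "T ** \<gamma> k = ?\<rho> k ** T" if k: "k \<in> O_grp" for k
  proof (cases "k \<in> SO_grp")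
    case True
    then show ?thesis by (simp add: \<gamma>_def rep_eps_def TS)
  next
    case False
    then have "det k = - 1" using k det_O_grp[OF k] by (auto simp: SO_grp_def O_grp_def rotation_matrix_def)
    then have ka: "k ** ?a \<in> SO_grp"
      using k a by (simp add: SO_grp_def O_grp_def rotation_matrix_def orthogonal_matrix_mul det_mul det_refl_mat)
    have "T ** \<gamma> k = (T ** \<pi> (k ** ?a)) ** A"
      using False by (simp add: \<gamma>_def rep_eps_def matrix_mul_assoc)
    also have "\<dots> = ?\<rho> (k ** ?a) ** (T ** A)"
      by (simp only: TS[OF ka] matrix_mul_assoc)
    also have "\<dots> = ?\<rho> k ** (?\<rho> ?a ** ?\<rho> ?a) ** T"
      by (simp only: TA unitary_repD(3)[OF \<rho>O k a] matrix_mul_assoc)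
    finally show ?thesis by (simp add: \<rho>aa)
  qed
  have \<gamma>: "unitary_rep O_grp \<gamma>"
    by (rule unitary_rep_of_embedding[OF \<rho>O compact_group_O c(2,1) TO])
  \<comment> \<open>every intertwiner for O(n) is one for SO(n), where \<open>\<gamma>\<close> is \<open>\<pi>\<close>\<close>
  have PO: "isotypic_proj M\<^sub>O \<tau> \<gamma> = isotypic_proj M\<^sub>S \<tau> \<pi>"
    unfolding PS
  proof (rule isotypic_proj_eq[OF assms(3) compact_group_O \<rho>O \<gamma> c(2,1) TO])
    fix T' assume T': "\<And>k. k \<in> O_grp \<Longrightarrow> T' ** \<gamma> k = ?\<rho> k ** T'"
    show "\<exists>b. T' = mat b ** T"
    proof (rule unique)
      fix k :: "real ^ 'n ^ 'n" assume k: "k \<in> SO_grp"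
      then have "k \<in> O_grp" using SO_subset_O by blast
      from T'[OF this] show "T' ** \<pi> k = ?\<rho> k ** T'" using k by (simp add: \<gamma>_def rep_eps_def)
    qed
  qed

  have "spherical M\<^sub>S \<tau> \<pi> (embO ?a) ` isotypic M\<^sub>S \<tau> \<pi> \<subseteq> isotypic M\<^sub>S \<tau> \<pi>"
    unfolding range[symmetric] using sph by auto
  moreover have "invertible A" using AA by (auto simp: invertible_def)
  ultimately show ?thesis
    using range AA tw PO by (simp add: isotypic_def spherical_def)
qed

end
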